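(* Let $K$ be a field, $S=K[x_1,\ldots,x_n]$, and let $I\subsetneq S$ be a monomial ideal which is an almost complete intersection. Then Stanley's Conjecture holds for $S/I$ and for $I$, that is, $\operatorname{depth}_S(S/I)\le \operatorname{sdepth}_S(S/I)$ and $\operatorname{depth}_S(I)\le \operatorname{sdepth}_S(I)$.
   Context: A proper nonzero ideal $I\subset S$ is an almost complete intersection if its minimal number of generators equals $\operatorname{height}(I)+1$. Let $M$ be a finitely generated $\mathbb{Z}^n$-graded $S$-module. A Stanley decomposition of $M$ is a finite direct sum decomposition $\mathcal{D}: M=\bigoplus_{i=1}^r m_iK[Z_i]$ as a $K$-vector space, where each $m_i\in M$ is homogeneous with respect to the $\mathbb{Z}^n$-grading, $Z_i\subset\{x_1,\ldots,x_n\}$, and $m_iK[Z_i]$ is a free $K[Z_i]$-module. Put $\operatorname{sdepth}(\mathcal{D})=\min_{i=1}^r|Z_i|$, and define the Stanley depth $\operatorname{sdepth}_S(M)=\max\{\operatorname{sdepth}(\mathcal{D}) : \mathcal{D}\text{ is a Stanley decomposition of }M\}$. $\operatorname{depth}_S(M)$ is the usual depth with respect to the maximal ideal $(x_1,\ldots,x_n)$. *)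

theory Defs
  imports
    "HOL-Library.Poly_Mapping"
    "HOL-Library.Extended_Nat"
    "HOL-Algebra.QuotRing"
    "HOL-Algebra.Module"
    "HOL-Algebra.Algebraic_Closure_Type"
begin

section \<open>Height and number of generators of an ideal\<close>

text \<open>The supremum of the lengths of chains of primes
  \<open>P\<^sub>0 \<subset> \<dots> \<subset> P\<^sub>k = P\<close>; the list \<open>Ps\<close> holds \<open>P\<^sub>0, \<dots>, P\<^sub>k\<^sub>-\<^sub>1\<close>.\<close>

definition prime_height :: "('a, 'b) ring_scheme \<Rightarrow> 'a set \<Rightarrow> enat" where
  "prime_height R P =
     Sup {enat (length Ps) | Ps. (\<forall>Q\<in>set Ps. primeideal Q R) \<and> sorted_wrt (\<subset>) (Ps @ [P])}"

definition height :: "('a, 'b) ring_scheme \<Rightarrow> 'a set \<Rightarrow> enat" where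
  "height R I = Inf {prime_height R P | P. primeideal P R \<and> I \<subseteq> P}"

definition min_gens :: "('a, 'b) ring_scheme \<Rightarrow> 'a set \<Rightarrow> enat" where
  "min_gens R I =
     Inf {enat (card A) | A. A \<subseteq> carrier R \<and> finite A \<and> genideal R A = I}"


section \<open>Ideals and quotients as modules\<close>

definition ideal_module :: "('a, 'b) ring_scheme \<Rightarrow> 'a set \<Rightarrow> ('a, 'a) module" where
  "ideal_module R I =
     \<lparr>carrier = I, monoid.mult = monoid.mult R, one = one R, ring.zero = ring.zero R,
      add = add R, module.smult = monoid.mult R\<rparr>"

definition quot_module :: "('a, 'b) ring_scheme \<Rightarrow> 'a set \<Rightarrow> ('a, 'a set) module" where
  "quot_module R I =
     \<lparr>carrier = carrier (R Quot I), monoid.mult = monoid.mult (R Quot I), one = one (R Quot I),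
      ring.zero = ring.zero (R Quot I), add = add (R Quot I),
      module.smult = (\<lambda>r C. monoid.mult (R Quot I) (I +>\<^bsub>R\<^esub> r) C)\<rparr>"

lemma ideal_module_is_module:
  assumes "cring R" and "ideal I R"
  shows "module R (ideal_module R I)"
proof -
  interpret cring R by fact
  interpret ideal I R by fact
  let ?M = "\<lparr>carrier = carrier R, monoid.mult = monoid.mult R, one = one R,
             ring.zero = ring.zero R, add = add R,
             module.smult = monoid.mult R\<rparr> :: ('a, 'a) module"
  have inv: "\<exists>y\<in>carrier R. y \<oplus>\<^bsub>R\<^esub> x = \<zero>\<^bsub>R\<^esub>" if "x \<in> carrier R" for x
    using that l_neg a_inv_closed by blast
  have ab: "abelian_group ?M"
    by (rule abelian_groupI) (simp_all add: a_ac inv)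
  have M: "module R ?M"
    by (rule moduleI[OF assms(1) ab]) (auto simp: l_distr r_distr m_assoc)
  have "submodule I R ?M"
  proof (rule module.submoduleI[OF M])
    fix a assume a: "a \<in> I"
    have "\<ominus>\<^bsub>?M\<^esub> a = \<ominus>\<^bsub>R\<^esub> a"
      by (simp add: a_inv_def m_inv_def)
    with a show "\<ominus>\<^bsub>?M\<^esub> a \<in> I" by simp
  qed (auto intro: I_l_closed)
  from submodule.submodule_is_module[OF this M] show ?thesis
    by (simp add: ideal_module_def)
qed

lemma quot_module_is_module:
  assumes "cring R" and "ideal I R"
  shows "module R (quot_module R I)"
proof -
  interpret cring R by fact
  interpret ideal I R by fact
  interpret Q: cring "R Quot I" by (rule quotient_is_cring[OF assms(1)])
  interpret h: ring_hom_ring R "R Quot I" "a_r_coset R I" by (rule rcos_ring_hom_ring)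
  have inv: "\<exists>D\<in>carrier (R Quot I). D \<oplus>\<^bsub>R Quot I\<^esub> C = \<zero>\<^bsub>R Quot I\<^esub>"
    if "C \<in> carrier (R Quot I)" for C
    using that Q.l_neg Q.a_inv_closed by blast
  have ab: "abelian_group (quot_module R I)"
    by (rule abelian_groupI)
       (simp_all add: quot_module_def Q.a_ac inv)
  show ?thesis
    by (rule moduleI[OF assms(1) ab])
       (simp_all add: quot_module_def Q.l_distr Q.r_distr Q.m_assoc)
qed


section \<open>Depth\<close>

definition submodule_span ::
  "('a, 'b) ring_scheme \<Rightarrow> ('a, 'm, 'c) module_scheme \<Rightarrow> 'm set \<Rightarrow> 'm set" where
  "submodule_span R M B = \<Inter>{N. submodule N R M \<and> B \<subseteq> N}"

text \<open>The submodule \<open>(A)M\<close> of \<open>M\<close>, for a set \<open>A\<close> of ring elements.\<close>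

definition ideal_smult ::
  "('a, 'b) ring_scheme \<Rightarrow> ('a, 'm, 'c) module_scheme \<Rightarrow> 'a set \<Rightarrow> 'm set" where
  "ideal_smult R M A = submodule_span R M {a \<odot>\<^bsub>M\<^esub> u | a u. a \<in> A \<and> u \<in> carrier M}"

text \<open>The second conjunct says that \<open>f\<^sub>i\<close> is a nonzerodivisor on
  \<open>M / (f\<^sub>1, \<dots>, f\<^sub>i\<^sub>-\<^sub>1)M\<close>, the third that \<open>M / (f\<^sub>1, \<dots>, f\<^sub>r)M\<close> is nonzero.\<close>

definition regular_sequence ::
  "('a, 'b) ring_scheme \<Rightarrow> ('a, 'm, 'c) module_scheme \<Rightarrow> 'a list \<Rightarrow> bool" where
  "regular_sequence R M fs \<longleftrightarrow>
     set fs \<subseteq> carrier R \<and>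
     (\<forall>i<length fs. \<forall>u\<in>carrier M.
        fs ! i \<odot>\<^bsub>M\<^esub> u \<in> ideal_smult R M (set (take i fs)) \<longrightarrow>
        u \<in> ideal_smult R M (set (take i fs))) \<and>
     ideal_smult R M (set fs) \<noteq> carrier M"

text \<open>Only meaningful for \<open>J M \<noteq> M\<close>; the convention that the depth is infinite if \<open>J M = M\<close>
  is not built in.\<close>

definition depth ::
  "('a, 'b) ring_scheme \<Rightarrow> 'a set \<Rightarrow> ('a, 'm, 'c) module_scheme \<Rightarrow> enat" where
  "depth R J M = Sup {enat (length fs) | fs. set fs \<subseteq> J \<and> regular_sequence R M fs}"


section \<open>The polynomial ring and its monomial ideals\<close>

text \<open>The variables are indexed by the finite type \<open>'n\<close>, so that \<open>n = CARD('n)\<close>.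
  A polynomial is the finitely supported family of its coefficients, indexed by
  the exponent vectors \<open>'n \<Rightarrow>\<^sub>0 nat\<close>; the product is convolution.\<close>

type_synonym ('n, 'k) mpoly = "('n \<Rightarrow>\<^sub>0 nat) \<Rightarrow>\<^sub>0 'k"

abbreviation mpoly_ring :: "('n::finite, 'k::field) mpoly ring" where
  "mpoly_ring \<equiv> ring_of_type_algebra"

definition monomial :: "('n::finite \<Rightarrow>\<^sub>0 nat) \<Rightarrow> ('n, 'k::field) mpoly" where
  "monomial a = Poly_Mapping.single a 1"

definition variable :: "'n::finite \<Rightarrow> ('n, 'k::field) mpoly" where
  "variable i = monomial (Poly_Mapping.single i 1)"

definition max_ideal :: "('n::finite, 'k::field) mpoly set" where
  "max_ideal = genideal mpoly_ring (range variable)"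

definition monomial_ideal :: "('n::finite, 'k::field) mpoly set \<Rightarrow> bool" where
  "monomial_ideal I \<longleftrightarrow> (\<exists>A. I = genideal mpoly_ring (monomial ` A))"

definition almost_complete_intersection :: "('n::finite, 'k::field) mpoly set \<Rightarrow> bool" where
  "almost_complete_intersection I \<longleftrightarrow>
     ideal I mpoly_ring \<and> I \<noteq> UNIV \<and> I \<noteq> {0} \<and> min_gens mpoly_ring I = height mpoly_ring I + 1"


section \<open>Stanley depth\<close>

text \<open>\<open>K[Z]\<close> as a subset of \<open>mpoly_ring\<close>.\<close>

definition polys_in :: "'n::finite set \<Rightarrow> ('n, 'k::field) mpoly set" where
  "polys_in Z = {f. \<forall>a\<in>Poly_Mapping.keys f. Poly_Mapping.keys a \<subseteq> Z}"

text \<open>A \<open>\<int>\<^sup>n\<close>-grading of a module is given by its family of homogeneous components.\<close>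

type_synonym ('n, 'm) grading = "('n \<Rightarrow> int) \<Rightarrow> 'm set"

definition poly_grading :: "('n::finite, ('n, 'k::field) mpoly) grading" where
  "poly_grading d = {f. \<forall>a\<in>Poly_Mapping.keys f. (\<lambda>i. int (Poly_Mapping.lookup a i)) = d}"

definition ideal_grading ::
  "('n::finite, 'k::field) mpoly set \<Rightarrow> ('n, ('n, 'k) mpoly) grading" where
  "ideal_grading I d = poly_grading d \<inter> I"

definition quot_grading ::
  "('n::finite, 'k::field) mpoly set \<Rightarrow> ('n, ('n, 'k) mpoly set) grading" where
  "quot_grading I d = (\<lambda>f. I +>\<^bsub>mpoly_ring\<^esub> f) ` poly_grading d"

definition internal_direct_sum ::
  "('m, 'c) ring_scheme \<Rightarrow> ('i \<Rightarrow> 'm set) \<Rightarrow> 'i set \<Rightarrow> bool" where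
  "internal_direct_sum M V J \<longleftrightarrow>
     (\<forall>j\<in>J. V j \<subseteq> carrier M) \<and>
     (\<forall>u\<in>carrier M. \<exists>!v. v \<in> (\<Pi>\<^sub>E j\<in>J. V j) \<and> u = (\<Oplus>\<^bsub>M\<^esub>j\<in>J. v j))"

text \<open>A decomposition \<open>M = \<Oplus>\<^sub>i m\<^sub>i K[Z\<^sub>i]\<close> is represented by the list of the pairs \<open>(m\<^sub>i, Z\<^sub>i)\<close>.
  As \<open>m\<^sub>i\<close> generates \<open>m\<^sub>i K[Z\<^sub>i]\<close>, freeness of this module over \<open>K[Z\<^sub>i]\<close> is
  read as: \<open>m\<^sub>i\<close> is a basis, that is, \<open>f \<mapsto> f m\<^sub>i\<close> is injective on \<open>K[Z\<^sub>i]\<close>. In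
  particular \<open>m\<^sub>i \<noteq> 0\<close>.\<close>

definition stanley_space ::
  "(('n::finite, 'k::field) mpoly, 'm, 'c) module_scheme \<Rightarrow> 'm \<times> 'n set \<Rightarrow> 'm set" where
  "stanley_space M = (\<lambda>(m, Z). (\<lambda>f. f \<odot>\<^bsub>M\<^esub> m) ` polys_in Z)"

definition stanley_decomposition ::
  "(('n::finite, 'k::field) mpoly, 'm, 'c) module_scheme \<Rightarrow> ('n, 'm) grading
     \<Rightarrow> ('m \<times> 'n set) list \<Rightarrow> bool" where
  "stanley_decomposition M G D \<longleftrightarrow>
     (\<forall>(m, Z)\<in>set D. m \<in> carrier M \<and> (\<exists>d. m \<in> G d) \<and>
        inj_on (\<lambda>f. f \<odot>\<^bsub>M\<^esub> m) (polys_in Z)) \<and>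
     internal_direct_sum M (\<lambda>i. stanley_space M (D ! i)) {..<length D}"

definition sdepth_decomposition :: "('m \<times> 'n::finite set) list \<Rightarrow> enat" where
  "sdepth_decomposition D = Inf {enat (card Z) | m Z. (m, Z) \<in> set D}"

text \<open>For \<open>M \<noteq> 0\<close> every decomposition is nonempty, so its Stanley depth is at most
  \<open>CARD('n)\<close>; hence the supremum is a maximum as soon as a decomposition exists.\<close>

definition sdepth ::
  "(('n::finite, 'k::field) mpoly, 'm, 'c) module_scheme \<Rightarrow> ('n, 'm) grading \<Rightarrow> enat" where
  "sdepth M G = Sup {sdepth_decomposition D | D. stanley_decomposition M G D}"

end

theory Submission
  imports Defs "HOL-Library.Cardinality" "HOL-Library.Countable"
begin

text \<open>
  Write \<open>n\<close> for the number of variables, \<open>G\<close> for the set of exponents of the minimal monomial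
  generators of \<open>I\<close>, and \<open>k\<close> for its cardinality. A monomial minimal generating set is as small as
  any generating set, so \<open>k \<le> ht I + 1\<close>. The argument compares explicit upper bounds for the depth
  with explicit lower bounds for the Stanley depth; it distinguishes whether or not every generator
  has a variable whose exponent in it is larger than in all other generators.

  If this is so, choosing one such variable for each generator gives a set \<open>Z\<close> of \<open>k\<close> variables,
  and dividing the least common multiple of the generators by the product of \<open>Z\<close> gives a monomial
  outside \<open>I\<close> that is multiplied into \<open>I\<close> by each variable of \<open>Z\<close>. If not, take for \<open>Z\<close> a minimal
  set of variables that meets the support of every generator. The prime generated by \<open>Z\<close> contains
  \<open>I\<close>, so \<open>|Z| \<ge> ht I \<ge> k - 1\<close>, because the height of this prime is at most \<open>|Z|\<close>
  (\<open>prime_height_var_ideal\<close>); and a high power of the product of the other variables lies outside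
  \<open>I\<close> but is multiplied into \<open>I\<close> by a power of each variable in \<open>Z\<close>. In both cases there is a monomial
  \<open>w \<notin> I\<close> with \<open>x\<^sub>i\<^sup>t w \<in> I\<close> for all \<open>i \<in> Z\<close> and no large exponents outside \<open>Z\<close>. It defines a nonzero
  class in the Koszul homology of \<open>S/I\<close> on \<open>x\<^sub>1\<^sup>t, \<dots>, x\<^sub>n\<^sup>t\<close> in degree \<open>|Z|\<close>, and its boundary one of
  \<open>I\<close> in degree \<open>|Z| - 1\<close>. Each element of a regular sequence pushes such a class up by one degree,
  and there is no homology above degree \<open>n\<close>; hence \<open>depth (S/I) \<le> n - |Z|\<close> and
  \<open>depth I \<le> n - |Z| + 1\<close> (\<open>depth_quot_module_le\<close>, \<open>depth_ideal_module_le\<close>).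

  A Stanley decomposition into spaces \<open>x\<^sup>v K[Z]\<close> is a partition of a set of exponents into boxes
  \<open>v + \<nat>\<^sup>Z\<close>. Sorting the exponents outside \<open>I\<close> by a coordinate that is too small for a given
  generator costs one dimension per generator, so \<open>sdepth (S/I) \<ge> n - k\<close>
  (\<open>splits_complement\<close>). When some generator \<open>g\<close> has in no variable the strictly largest exponent,
  a coordinate too small for \<open>g\<close> is too small for a second generator as well, and one gains one
  dimension (\<open>splits_complement_redundant\<close>). The exponents in \<open>I\<close> are sorted by the set of
  generators that divide them. Splitting the nonempty subsets of \<open>G\<close> into intervals with large
  top elements gives \<open>sdepth I \<ge> n - k + 1\<close>, and \<open>sdepth I \<ge> n - k + 2\<close> when \<open>k \<ge> 3\<close>
  (\<open>splits_ideal\<close>, \<open>splits_ideal_three\<close>). These numbers dominate the bounds for the depth in each of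
  the two cases.
\<close>

section \<open>Partitions of sets of exponents into boxes\<close>

definition box :: "('n \<Rightarrow> nat) \<Rightarrow> 'n set \<Rightarrow> ('n \<Rightarrow> nat) set" where
  "box v Z = {u. v \<le> u \<and> (\<forall>i. i \<notin> Z \<longrightarrow> u i = v i)}"

text \<open>
  A partition of a set of exponents into finitely many boxes \<open>v + \<nat>\<^sup>Z\<close> with \<open>|Z| \<ge> d\<close>: the
  combinatorial content of the statement that the Stanley depth is at least \<open>d\<close>.
\<close>

inductive splits :: "nat \<Rightarrow> ('n::finite \<Rightarrow> nat) set \<Rightarrow> bool" for d where
  empty: "splits d {}"
| box: "d \<le> card Z \<Longrightarrow> splits d (box v Z)"
| union: "splits d A \<Longrightarrow> splits d B \<Longrightarrow> A \<inter> B = {} \<Longrightarrow> splits d (A \<union> B)"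

lemma splits_mono:
  assumes "splits d A" "d' \<le> d"
  shows "splits d' A"
  using assms by induction (auto intro: splits.intros)

lemma splits_UN:
  assumes "finite J" "\<And>j. j \<in> J \<Longrightarrow> splits d (A j)" "disjoint_family_on A J"
  shows "splits d (\<Union>j\<in>J. A j)"
  using assms
proof (induction J rule: finite_induct)
  case empty
  then show ?case by (simp add: splits.empty)
next
  case (insert j J)
  have "A j \<inter> (\<Union>j\<in>J. A j) = {}"
    using insert.prems(2) insert.hyps(2) by (auto simp: disjoint_family_on_def)
  moreover have "splits d (\<Union>j\<in>J. A j)"
    using insert by (auto simp: disjoint_family_on_def)
  ultimately show ?case
    using insert.prems(1) by (auto intro: splits.union)
qed

text \<open>
  The exponents with some coordinate below that of \<open>g\<close> are sorted by the first such coordinate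
  \<open>i\<close>, in some order of the coordinates, and by the value there. Fixing this value removes \<open>i\<close>
  from the free coordinates; the earlier coordinates are bounded below by those of \<open>g\<close>, which
  only moves the corner of the box. The predicate \<open>P\<close> stands for constraints that are dealt
  with inside the smaller boxes, where it is known that coordinate \<open>i\<close> is too small for \<open>g\<close>.
\<close>

lemma splits_small_coordinate:
  fixes P :: "('n::finite \<Rightarrow> nat) \<Rightarrow> bool"
  assumes "\<And>v' i. i \<in> Z \<Longrightarrow> v' i < g i \<Longrightarrow> splits d {u \<in> box v' (Z - {i}). P u}"
    and "W \<subseteq> Z"
  shows "splits d {u \<in> box v Z. P u \<and> (\<exists>i\<in>W. u i < g i)}"
proof -
  have "finite W" by simp
  then show ?thesis using assms(2)
  proof (induction W arbitrary: v rule: finite_induct)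
    case empty
    then show ?case by (simp add: splits.empty)
  next
    case (insert i W)
    let ?A = "\<lambda>c. {u \<in> box (v(i := c)) (Z - {i}). P u}"
    let ?v = "v(i := max (v i) (g i))"
    let ?B = "{u \<in> box ?v Z. P u \<and> (\<exists>j\<in>W. u j < g j)}"
    \<comment> \<open>\<open>?A c\<close> collects the exponents whose coordinate \<open>i\<close> is \<open>c\<close>, too small for \<open>g\<close>; for those in
        \<open>?B\<close> it is large enough, and one goes on with the coordinates in \<open>W\<close>.\<close>
    have eq: "{u \<in> box v Z. P u \<and> (\<exists>j\<in>insert i W. u j < g j)} = (\<Union>c\<in>{v i..<g i}. ?A c) \<union> ?B"
      (is "?L = ?R")
    proof (rule Set.set_eqI)
      fix u
      show "u \<in> ?L \<longleftrightarrow> u \<in> ?R"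
      proof (cases "u i < g i")
        case True
        have "u \<in> box v Z \<longleftrightarrow> u i \<in> {v i..<g i} \<and> u \<in> box (v(i := u i)) (Z - {i})"
          using True insert.prems by (auto simp: box_def le_fun_def)
        moreover have "u \<notin> box ?v Z"
          using True le_funD[of ?v u i] by (auto simp: box_def)
        moreover have "c = u i" if "u \<in> box (v(i := c)) (Z - {i})" for c
          using that by (simp add: box_def)
        moreover have "\<exists>j\<in>insert i W. u j < g j" using True by blast
        ultimately show ?thesis by blast
      next
        case False
        have "u \<in> box v Z \<longleftrightarrow> u \<in> box ?v Z"
          using False insert.prems by (auto simp: box_def le_fun_def)
        moreover have "u \<notin> box (v(i := c)) (Z - {i})" if "c \<in> {v i..<g i}" for c
          using False that by (auto simp: box_def)
        ultimately show ?thesis using False by blast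
      qed
    qed
    have "splits d (\<Union>c\<in>{v i..<g i}. ?A c)"
    proof (rule splits_UN)
      show "splits d (?A c)" if "c \<in> {v i..<g i}" for c
        using that insert.prems by (intro assms(1)) auto
      show "disjoint_family_on ?A {v i..<g i}"
        unfolding disjoint_family_on_def by (auto simp: box_def)
    qed simp
    moreover have "splits d ?B" using insert by auto
    moreover have "(\<Union>c\<in>{v i..<g i}. ?A c) \<inter> ?B = {}"
    proof -
      have "u i < g i" if "u \<in> (\<Union>c\<in>{v i..<g i}. ?A c)" for u
        using that by (auto simp: box_def)
      moreover have "g i \<le> u i" if "u \<in> ?B" for u
        using that le_funD[of ?v u i] by (auto simp: box_def)
      ultimately show ?thesis by (meson disjoint_iff leD)
    qed
    ultimately show ?case unfolding eq by (rule splits.union)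
  qed
qed

text \<open>
  Each monomial costs one dimension. It has to be excluded inside arbitrary boxes, since the
  boxes left over by one monomial are cut again by the next.
\<close>

lemma splits_avoid:
  fixes G :: "('n::finite \<Rightarrow> nat) set"
  assumes "finite G"
  shows "splits (card Z - card G) {u \<in> box v Z. \<forall>g\<in>G. \<not> g \<le> u}"
  using assms
proof (induction G arbitrary: v Z rule: finite_induct)
  case empty
  then show ?case by (simp add: splits.box)
next
  case (insert g G)
  let ?d = "card Z - card (insert g G)"
  show ?case
  proof (cases "\<exists>i. i \<notin> Z \<and> v i < g i")
    \<comment> \<open>A fixed coordinate is too small for \<open>g\<close>, so that \<open>g\<close> excludes nothing from the box.\<close>
    case True
    then have "{u \<in> box v Z. \<forall>g\<in>insert g G. \<not> g \<le> u} = {u \<in> box v Z. \<forall>g\<in>G. \<not> g \<le> u}"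
      by (auto simp: box_def le_fun_def not_le) metis
    moreover have "?d \<le> card Z - card G" using insert.hyps by simp
    ultimately show ?thesis using splits_mono[OF insert.IH[of Z v]] by simp
  next
    case False
    have "splits ?d {u \<in> box v Z. (\<forall>g\<in>G. \<not> g \<le> u) \<and> (\<exists>i\<in>Z. u i < g i)}"
    proof (rule splits_small_coordinate)
      fix v' and i :: 'n
      assume "i \<in> Z"
      then show "splits ?d {u \<in> box v' (Z - {i}). \<forall>g\<in>G. \<not> g \<le> u}"
        using insert.hyps by (intro splits_mono[OF insert.IH[of "Z - {i}" v']]) simp
    qed simp
    also have "{u \<in> box v Z. (\<forall>g\<in>G. \<not> g \<le> u) \<and> (\<exists>i\<in>Z. u i < g i)} =
        {u \<in> box v Z. \<forall>g\<in>insert g G. \<not> g \<le> u}"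
    proof -
      have "(\<exists>i\<in>Z. u i < g i) \<longleftrightarrow> \<not> g \<le> u" if "u \<in> box v Z" for u
      proof -
        have "i \<in> Z" if "u i < g i" for i
          using that \<open>u \<in> box v Z\<close> False by (cases "i \<in> Z") (auto simp: box_def)
        then show ?thesis by (auto simp: le_fun_def not_le)
      qed
      then show ?thesis by blast
    qed
    finally show ?thesis .
  qed
qed

lemma splits_complement:
  fixes G :: "('n::finite \<Rightarrow> nat) set"
  assumes "finite G"
  shows "splits (CARD('n) - card G) {u. \<forall>g\<in>G. \<not> g \<le> u}"
  using splits_avoid[OF assms, of UNIV "\<lambda>_. 0"] by (simp add: box_def le_fun_def)

text \<open>
  The hypothesis says that \<open>g0\<close> divides the least common multiple of the other elements of
  \<open>G\<close>. Every exponent of the complement has a coordinate \<open>i\<close> that is too small for \<open>g0\<close>, and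
  then it is also too small for some other element of \<open>G\<close>. Fixing it costs one dimension but
  disposes of two elements of \<open>G\<close>.
\<close>

lemma splits_complement_redundant:
  fixes G :: "('n::finite \<Rightarrow> nat) set"
  assumes "finite G" "g0 \<in> G" and red: "\<And>i. 0 < g0 i \<Longrightarrow> \<exists>g\<in>G - {g0}. g0 i \<le> g i"
  shows "splits (CARD('n) - 1 - (card G - 2)) {u. \<forall>g\<in>G. \<not> g \<le> u}"
proof -
  have "splits (CARD('n) - 1 - (card G - 2))
          {u \<in> box (\<lambda>_. 0) UNIV. (\<forall>g\<in>G. \<not> g \<le> u) \<and> (\<exists>i\<in>UNIV. u i < g0 i)}"
  proof (rule splits_small_coordinate)
    fix v' :: "'n \<Rightarrow> nat" and i
    assume i: "v' i < g0 i"
    obtain g1 where g1: "g1 \<in> G - {g0}" "g0 i \<le> g1 i" using red[of i] i by force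
    let ?G = "G - {g0, g1}"
    have "card ?G = card G - 2"
      using assms(1,2) g1(1) by (subst card_Diff_subset) auto
    then have "splits (CARD('n) - 1 - (card G - 2)) {u \<in> box v' (UNIV - {i}). \<forall>g\<in>?G. \<not> g \<le> u}"
      using splits_avoid[of ?G "UNIV - {i}" v'] assms(1) by simp
    also have "{u \<in> box v' (UNIV - {i}). \<forall>g\<in>?G. \<not> g \<le> u} = {u \<in> box v' (UNIV - {i}). \<forall>g\<in>G. \<not> g \<le> u}"
    proof -
      have "\<not> g0 \<le> u" "\<not> g1 \<le> u" if "u \<in> box v' (UNIV - {i})" for u
      proof -
        have "u i = v' i" using that by (simp add: box_def)
        then have "u i < g0 i" "u i < g1 i" using i g1(2) by auto
        then show "\<not> g0 \<le> u" "\<not> g1 \<le> u" by (auto simp: le_fun_def not_le)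
      qed
      then show ?thesis by blast
    qed
    finally show "splits (CARD('n) - 1 - (card G - 2)) {u \<in> box v' (UNIV - {i}). \<forall>g\<in>G. \<not> g \<le> u}" .
  qed simp
  also have "{u \<in> box (\<lambda>_. 0) UNIV. (\<forall>g\<in>G. \<not> g \<le> u) \<and> (\<exists>i\<in>UNIV. u i < g0 i)} = {u. \<forall>g\<in>G. \<not> g \<le> u}"
    using assms(2) by (auto simp: box_def le_fun_def not_le)
  finally show ?thesis .
qed

text \<open>
  The exponents that are divisible by all of \<open>A\<close> and by nothing outside \<open>B\<close> are the multiples
  of the least common multiple of \<open>A\<close> that avoid \<open>G - B\<close>, so the larger \<open>B\<close> is, the fewer
  dimensions are lost.
\<close>

lemma splits_interval:
  fixes G :: "('n::finite \<Rightarrow> nat) set"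
  assumes "finite G" "A \<subseteq> B" "B \<subseteq> G"
  shows "splits (CARD('n) - (card G - card B)) {u. A \<subseteq> {g \<in> G. g \<le> u} \<and> {g \<in> G. g \<le> u} \<subseteq> B}"
proof -
  let ?lcm = "\<lambda>i. Max (insert 0 ((\<lambda>g. g i) ` A))"
  have fin: "finite A" "finite B" using assms by (auto dest: finite_subset)
  have "splits (CARD('n) - (card G - card B)) {u \<in> box ?lcm UNIV. \<forall>g\<in>G - B. \<not> g \<le> u}"
    using splits_avoid[of "G - B" UNIV ?lcm] assms fin by (simp add: card_Diff_subset)
  also have "{u \<in> box ?lcm UNIV. \<forall>g\<in>G - B. \<not> g \<le> u} =
      {u. A \<subseteq> {g \<in> G. g \<le> u} \<and> {g \<in> G. g \<le> u} \<subseteq> B}"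
    using assms fin by (auto simp: box_def le_fun_def)
  finally show ?thesis .
qed

text \<open>
  Sorting the exponents of the ideal by the set of generators dividing them turns a partition
  of the nonempty subsets of \<open>G\<close> into intervals \<open>[lo j, hi j]\<close> into a partition into boxes.
\<close>

lemma splits_intervals:
  fixes G :: "('n::finite \<Rightarrow> nat) set"
  assumes "finite G" "finite J" "\<And>j. j \<in> J \<Longrightarrow> lo j \<subseteq> hi j \<and> hi j \<subseteq> G \<and> card G - card (hi j) \<le> e"
    and ex1: "\<And>A. A \<subseteq> G \<Longrightarrow> A \<noteq> {} \<Longrightarrow> \<exists>!j. j \<in> J \<and> lo j \<subseteq> A \<and> A \<subseteq> hi j"
    and ne: "\<And>j. j \<in> J \<Longrightarrow> lo j \<noteq> {}"
  shows "splits (CARD('n) - e) {u. \<exists>g\<in>G. g \<le> u}"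
proof -
  let ?S = "\<lambda>u. {g \<in> G. g \<le> u}"
  let ?A = "\<lambda>j. {u. lo j \<subseteq> ?S u \<and> ?S u \<subseteq> hi j}"
  have "splits (CARD('n) - e) (\<Union>j\<in>J. ?A j)"
  proof (rule splits_UN[OF \<open>finite J\<close>])
    fix j assume j: "j \<in> J"
    show "splits (CARD('n) - e) (?A j)"
      using assms(3)[OF j] splits_interval[OF assms(1), of "lo j" "hi j"]
      by (auto intro: splits_mono diff_le_mono2)
  next
    have "j = k" if jk: "j \<in> J" "k \<in> J" and u: "u \<in> ?A j" "u \<in> ?A k" for u j k
    proof -
      have "?S u \<noteq> {}" using ne[OF jk(1)] u(1) by blast
      then have "\<exists>!j. j \<in> J \<and> lo j \<subseteq> ?S u \<and> ?S u \<subseteq> hi j" by (intro ex1) auto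
      then show ?thesis using jk u by (elim ex1E) (metis (no_types, lifting) mem_Collect_eq)
    qed
    then show "disjoint_family_on ?A J"
      unfolding disjoint_family_on_def by blast
  qed
  also have "(\<Union>j\<in>J. ?A j) = {u. \<exists>g\<in>G. g \<le> u}" (is "?L = ?R")
  proof (rule Set.set_eqI)
    fix u
    have "(\<exists>j\<in>J. u \<in> ?A j) \<longleftrightarrow> ?S u \<noteq> {}"
    proof
      assume "?S u \<noteq> {}"
      then show "\<exists>j\<in>J. u \<in> ?A j" using ex1[of "?S u"] by blast
    qed (use ne in blast)
    then show "u \<in> ?L \<longleftrightarrow> u \<in> ?R" by auto
  qed
  finally show ?thesis .
qed

lemma splits_ideal:
  fixes G :: "('n::finite \<Rightarrow> nat) set"
  assumes "finite G"
  shows "splits (CARD('n) - (card G - 1)) {u. \<exists>g\<in>G. g \<le> u}"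
proof (rule splits_intervals[where J = "Pow G - {{}}" and lo = "\<lambda>A. A" and hi = "\<lambda>A. A"])
  fix A assume "A \<in> Pow G - {{}}"
  then have "A \<subseteq> G" "A \<noteq> {}" "finite A" using assms finite_subset by auto
  then show "A \<subseteq> A \<and> A \<subseteq> G \<and> card G - card A \<le> card G - 1"
    by (simp add: diff_le_mono2 Suc_leI card_gt_0_iff)
qed (use assms in auto)

text \<open>
  The nonempty subsets of \<open>G\<close> are divided into intervals whose top elements have at least two
  elements. Each singleton \<open>{g}\<close> is paired with \<open>{g, \<sigma> g}\<close>, and all other subsets form
  intervals of their own. For the pairs \<open>{g, \<sigma> g}\<close> to be different, \<open>\<sigma>\<close> runs through a
  triangle \<open>a, b, c\<close> and sends everything else to \<open>a\<close>; this is where three elements are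
  needed.
\<close>

lemma splits_ideal_three:
  fixes G :: "('n::finite \<Rightarrow> nat) set"
  assumes "finite G" "3 \<le> card G"
  shows "splits (CARD('n) - (card G - 2)) {u. \<exists>g\<in>G. g \<le> u}"
proof -
  obtain T where "T \<subseteq> G" "card T = 3" using assms by (meson obtain_subset_with_card_n)
  then obtain a b c where abc: "a \<in> G" "b \<in> G" "c \<in> G" "a \<noteq> b" "b \<noteq> c" "a \<noteq> c"
    by (auto simp: card_3_iff)
  define \<sigma> where "\<sigma> g = (if g = a then b else if g = b then c else a)" for g
  have \<sigma>: "\<sigma> g \<in> G" "\<sigma> g \<noteq> g" for g using abc by (auto simp: \<sigma>_def)
  have \<sigma>_inj: "g = h" if "{g, \<sigma> g} = {h, \<sigma> h}" for g h
  proof -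
    have "\<sigma> (\<sigma> h) \<noteq> h" using abc by (simp add: \<sigma>_def)
    then show ?thesis using that unfolding doubleton_eq_iff by blast
  qed
  \<comment> \<open>The intervals are indexed by their top elements; \<open>lo A\<close> is the bottom of the one with top \<open>A\<close>.\<close>
  define lo where "lo A = (if \<exists>g\<in>G. A = {g, \<sigma> g} then {THE g. A = {g, \<sigma> g}} else A)" for A
  have lo1: "lo {g, \<sigma> g} = {g}" if "g \<in> G" for g
  proof -
    have "(THE h. {g, \<sigma> g} = {h, \<sigma> h}) = g" using \<sigma>_inj by (intro the_equality) auto
    then show ?thesis unfolding lo_def using that by auto
  qed
  have lo2: "lo A = A" if "\<not> (\<exists>g\<in>G. A = {g, \<sigma> g})" for A using that by (simp add: lo_def)
  show ?thesis
  proof (rule splits_intervals[where J = "{A. A \<subseteq> G \<and> 2 \<le> card A}" and lo = lo and hi = "\<lambda>A. A"])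
    fix A assume A: "A \<in> {A. A \<subseteq> G \<and> 2 \<le> card A}"
    have "lo A \<subseteq> A" using lo1 lo2 by (cases "\<exists>g\<in>G. A = {g, \<sigma> g}") auto
    then show "lo A \<subseteq> A \<and> A \<subseteq> G \<and> card G - card A \<le> card G - 2"
      using A by auto
    show "lo A \<noteq> {}" using lo1 lo2 A by (cases "\<exists>g\<in>G. A = {g, \<sigma> g}") auto
  next
    fix A assume A: "A \<subseteq> G" "A \<noteq> {}"
    have "finite A" using A assms finite_subset by blast
    show "\<exists>!B. B \<in> {A. A \<subseteq> G \<and> 2 \<le> card A} \<and> lo B \<subseteq> A \<and> A \<subseteq> B"
    proof (cases "card A = 1")
      case True
      then obtain g where g: "A = {g}" by (auto simp: card_1_singleton_iff)
      show ?thesis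
      proof (rule ex1I[of _ "{g, \<sigma> g}"])
        show "{g, \<sigma> g} \<in> {A. A \<subseteq> G \<and> 2 \<le> card A} \<and> lo {g, \<sigma> g} \<subseteq> A \<and> A \<subseteq> {g, \<sigma> g}"
          using g A \<sigma>[of g] lo1 by auto
      next
        fix B assume B: "B \<in> {A. A \<subseteq> G \<and> 2 \<le> card A} \<and> lo B \<subseteq> A \<and> A \<subseteq> B"
        show "B = {g, \<sigma> g}"
        proof (cases "\<exists>h\<in>G. B = {h, \<sigma> h}")
          case True
          then show ?thesis using B lo1 g by auto
        next
          case False
          then have "B \<subseteq> {g}" using B lo2 g by auto
          then have "card B \<le> 1"
            by (metis card_mono card.empty card_insert_disjoint empty_iff finite.emptyI
                finite_insert One_nat_def)
          then show ?thesis using B by auto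
        qed
      qed
    next
      case False
      then have cA: "2 \<le> card A" using A \<open>finite A\<close>
        by (metis One_nat_def Suc_1 Suc_leI card_gt_0_iff le_neq_implies_less)
      show ?thesis
      proof (rule ex1I[of _ A])
        show "A \<in> {A. A \<subseteq> G \<and> 2 \<le> card A} \<and> lo A \<subseteq> A \<and> A \<subseteq> A"
          using A cA lo1 lo2 by (cases "\<exists>g\<in>G. A = {g, \<sigma> g}") auto
      next
        fix B assume B: "B \<in> {A. A \<subseteq> G \<and> 2 \<le> card A} \<and> lo B \<subseteq> A \<and> A \<subseteq> B"
        show "B = A"
        proof (cases "\<exists>h\<in>G. B = {h, \<sigma> h}")
          case True
          then obtain h where h: "B = {h, \<sigma> h}" by auto
          have "card B = 2" using h \<sigma>(2)[of h] by auto
          then show ?thesis using cA B card_seteq[of B A] h by auto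
        next
          case False
          then show ?thesis using B lo2 by auto
        qed
      qed
    qed
  qed (use assms in auto)
qed

section \<open>Polynomials supported on a set of exponents\<close>

abbreviation lookup :: "('a \<Rightarrow>\<^sub>0 'b::zero) \<Rightarrow> 'a \<Rightarrow> 'b" where
  "lookup \<equiv> Poly_Mapping.lookup"

abbreviation keys :: "('a \<Rightarrow>\<^sub>0 'b::zero) \<Rightarrow> 'a set" where
  "keys \<equiv> Poly_Mapping.keys"

abbreviation expo :: "('n::finite \<Rightarrow> nat) \<Rightarrow> ('n \<Rightarrow>\<^sub>0 nat)" where
  "expo \<equiv> Abs_poly_mapping"

lemma lookup_expo [simp]: "lookup (expo u) = u" for u :: "'n::finite \<Rightarrow> nat"
  by simp

lemma expo_lookup [simp]: "expo (lookup a) = a"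
  by (rule poly_mapping.lookup_inverse)

lemma expo_eq_iff [simp]: "expo u = expo v \<longleftrightarrow> u = v"
  by (metis lookup_expo)

lemma exponent_add_diff: "a + (b - a) = b" if "lookup a \<le> lookup b" for a b :: "'n \<Rightarrow>\<^sub>0 nat"
  using that by (intro poly_mapping_eqI) (simp add: lookup_add lookup_minus le_fun_def)

lemma poly_mapping_sum_single: "f = (\<Sum>a\<in>keys f. Poly_Mapping.single a (lookup f a))"
  by (rule poly_mapping_eqI)
     (auto simp: lookup_sum lookup_single when_def in_keys_iff)

lemma lookup_single_mult:
  fixes f :: "('n::finite, 'k::field) mpoly"
  shows "lookup (Poly_Mapping.single a c * f) b =
    (if lookup a \<le> lookup b then c * lookup f (b - a) else 0)"
proof -
  have "lookup (Poly_Mapping.single a c * f) b =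
      lookup (\<Sum>d\<in>keys f. Poly_Mapping.single (a + d) (c * lookup f d)) b"
    by (subst (1) poly_mapping_sum_single[of f]) (simp add: sum_distrib_left mult_single)
  also have "\<dots> = (\<Sum>d\<in>keys f. if a + d = b then c * lookup f d else 0)"
    by (simp add: lookup_sum lookup_single when_def)
  also have "\<dots> = (if lookup a \<le> lookup b then c * lookup f (b - a) else 0)"
  proof (cases "lookup a \<le> lookup b")
    case True
    then have "a + d = b \<longleftrightarrow> d = b - a" for d
      using exponent_add_diff[OF True] add_diff_cancel_left'[of a d] by auto
    then show ?thesis using True by (auto simp: in_keys_iff)
  next
    case False
    then have "a + d \<noteq> b" for d
      by (auto simp: lookup_add le_fun_def)
    then show ?thesis using False by simp
  qed
  finally show ?thesis .
qed

lemma lookup_single_mult_add [simp]: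
  fixes f :: "('n::finite, 'k::field) mpoly"
  shows "lookup (Poly_Mapping.single a c * f) (a + b) = c * lookup f b"
  by (simp add: lookup_single_mult lookup_add le_fun_def)

lemma lookup_mult_sum:
  fixes f g :: "('n::finite, 'k::field) mpoly"
  shows "lookup (f * g) c =
    (\<Sum>a\<in>keys f. if lookup a \<le> lookup c then lookup f a * lookup g (c - a) else 0)"
  by (subst (1) poly_mapping_sum_single[of f])
     (simp add: sum_distrib_right lookup_sum lookup_single_mult)

definition polys_on :: "('n::finite \<Rightarrow> nat) set \<Rightarrow> ('n, 'k::field) mpoly set" where
  "polys_on U = {f. \<forall>a\<in>keys f. lookup a \<in> U}"

lemma polys_on_iff: "f \<in> polys_on U \<longleftrightarrow> (\<forall>a. lookup a \<notin> U \<longrightarrow> lookup f a = 0)"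
  by (auto simp: polys_on_def in_keys_iff)

lemma polys_on_zero [simp]: "0 \<in> polys_on U"
  and polys_on_add [intro]: "f \<in> polys_on U \<Longrightarrow> g \<in> polys_on U \<Longrightarrow> f + g \<in> polys_on U"
  and polys_on_diff [intro]: "f \<in> polys_on U \<Longrightarrow> g \<in> polys_on U \<Longrightarrow> f - g \<in> polys_on U"
  by (auto simp: polys_on_iff lookup_add lookup_minus)

lemma polys_on_sum: "(\<And>j. j \<in> J \<Longrightarrow> f j \<in> polys_on U) \<Longrightarrow> sum f J \<in> polys_on U"
  by (auto simp: polys_on_iff lookup_sum)

lemma polys_on_mono: "U \<subseteq> V \<Longrightarrow> polys_on U \<subseteq> polys_on V"
  by (auto simp: polys_on_def)

lemma monomial_in_polys_on [simp]: "monomial a \<in> polys_on U \<longleftrightarrow> lookup a \<in> U"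
  by (simp add: polys_on_def monomial_def)

definition upset :: "('n \<Rightarrow> nat) set \<Rightarrow> bool" where
  "upset U \<longleftrightarrow> (\<forall>u\<in>U. \<forall>v. u \<le> v \<longrightarrow> v \<in> U)"

lemma upsetD: "upset U \<Longrightarrow> u \<in> U \<Longrightarrow> u \<le> v \<Longrightarrow> v \<in> U"
  by (auto simp: upset_def)

lemma polys_on_mult:
  fixes f g :: "('n::finite, 'k::field) mpoly"
  assumes "upset U" "f \<in> polys_on U"
  shows "g * f \<in> polys_on U"
  unfolding polys_on_iff
proof (intro allI impI)
  fix c :: "'n \<Rightarrow>\<^sub>0 nat"
  assume c: "lookup c \<notin> U"
  have "lookup f (c - a) = 0" for a
  proof -
    have "lookup (c - a) \<le> lookup c" by (simp add: le_fun_def lookup_minus)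
    then have "lookup (c - a) \<notin> U" using c upsetD[OF assms(1)] by blast
    then show ?thesis using assms(2) by (simp add: polys_on_iff)
  qed
  then show "lookup (g * f) c = 0" unfolding lookup_mult_sum by (intro sum.neutral) auto
qed

definition part :: "('n::finite \<Rightarrow> nat) set \<Rightarrow> ('n, 'k::field) mpoly \<Rightarrow> ('n, 'k) mpoly" where
  "part U f = Poly_Mapping.mapp (\<lambda>a c. if lookup a \<in> U then c else 0) f"

lemma lookup_part: "lookup (part U f) a = (if lookup a \<in> U then lookup f a else 0)"
  by (simp add: part_def lookup_mapp when_def in_keys_iff)

lemma part_in_polys_on [simp]: "part U f \<in> polys_on U"
  by (simp add: polys_on_iff lookup_part)

lemma ring_of_type_simps [simp]:
  "carrier ring_of_type_algebra = UNIV"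
  "monoid.mult ring_of_type_algebra = (*)"
  "one ring_of_type_algebra = 1"
  "ring.zero ring_of_type_algebra = 0"
  "add ring_of_type_algebra = (+)"
  by (simp_all add: ring_of_type_algebra_def)

text \<open>Ideals in terms of the type class operations, without the carrier of a ring record.\<close>

definition ideal_set :: "'a::comm_ring_1 set \<Rightarrow> bool" where
  "ideal_set I \<longleftrightarrow> 0 \<in> I \<and> (\<forall>x\<in>I. \<forall>y\<in>I. x + y \<in> I) \<and> (\<forall>x\<in>I. \<forall>r. r * x \<in> I)"

lemma ideal_set_closed:
  assumes "ideal_set I"
  shows "0 \<in> I" "x \<in> I \<Longrightarrow> y \<in> I \<Longrightarrow> x + y \<in> I" "x \<in> I \<Longrightarrow> r * x \<in> I" "x \<in> I \<Longrightarrow> x * r \<in> I"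
    "x \<in> I \<Longrightarrow> - x \<in> I" "x \<in> I \<Longrightarrow> y \<in> I \<Longrightarrow> x - y \<in> I"
proof -
  show 1: "0 \<in> I" "x \<in> I \<Longrightarrow> y \<in> I \<Longrightarrow> x + y \<in> I" "x \<in> I \<Longrightarrow> r * x \<in> I" for x y r
    using assms by (auto simp: ideal_set_def)
  show "x \<in> I \<Longrightarrow> x * r \<in> I" using 1(3)[of x r] by (simp add: mult.commute)
  show 2: "x \<in> I \<Longrightarrow> - x \<in> I" for x using 1(3)[of x "-1"] by simp
  show "x \<in> I \<Longrightarrow> y \<in> I \<Longrightarrow> x - y \<in> I" using 1(2)[of x "-y"] 2[of y] by simp
qed

lemma ideal_set_sum: "ideal_set I \<Longrightarrow> (\<And>j. j \<in> J \<Longrightarrow> f j \<in> I) \<Longrightarrow> sum f J \<in> I"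
  by (induction J rule: infinite_finite_induct) (auto intro: ideal_set_closed)

lemma ideal_ring_of_type_iff:
  "ideal I (ring_of_type_algebra :: 'a::comm_ring_1 ring) \<longleftrightarrow> ideal_set I"
proof
  let ?R = "ring_of_type_algebra :: 'a ring"
  assume "ideal I ?R"
  then interpret ideal I ?R .
  show "ideal_set I"
    unfolding ideal_set_def
    using additive_subgroup.zero_closed[OF is_additive_subgroup]
      additive_subgroup.a_closed[OF is_additive_subgroup] I_l_closed
    by auto
next
  let ?R = "ring_of_type_algebra :: 'a ring"
  assume I: "ideal_set I"
  show "ideal I ?R"
  proof (rule idealI)
    show "ring ?R" by (rule ring_from_type_algebra)
    then interpret ring ?R .
    show "subgroup I (add_monoid ?R)"
    proof
      fix x assume x: "x \<in> I"
      have "inv\<^bsub>add_monoid ?R\<^esub> x = - x"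
        using minus_equality[of "-x" x] by (simp add: a_inv_def)
      then show "inv\<^bsub>add_monoid ?R\<^esub> x \<in> I" using x I by (simp add: ideal_set_closed)
    qed (use I in \<open>auto simp: ideal_set_closed\<close>)
  qed (use I in \<open>auto simp: ideal_set_closed\<close>)
qed

lemma genideal_ring_of_type:
  "genideal (ring_of_type_algebra :: 'a::comm_ring_1 ring) A = \<Inter>{I. ideal_set I \<and> A \<subseteq> I}"
  by (simp add: genideal_def ideal_ring_of_type_iff)

lemma ideal_set_polys_on: "upset U \<Longrightarrow> ideal_set (polys_on U)"
  by (auto simp: ideal_set_def polys_on_mult)

lemma genideal_monomials:
  "genideal mpoly_ring (monomial ` A) =
     (polys_on {u. \<exists>a\<in>A. lookup a \<le> u} :: ('n::finite, 'k::field) mpoly set)"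
  (is "_ = polys_on ?U")
proof (rule equalityI)
  have "upset ?U" by (force simp: upset_def intro: order_trans)
  then show "genideal mpoly_ring (monomial ` A) \<subseteq> polys_on ?U"
    unfolding genideal_ring_of_type
    by (intro Inter_lower) (auto simp: ideal_set_polys_on)
next
  show "(polys_on ?U :: ('n, 'k) mpoly set) \<subseteq> genideal mpoly_ring (monomial ` A)"
  proof
    fix f :: "('n, 'k) mpoly"
    assume f: "f \<in> polys_on ?U"
    have "f \<in> I" if I: "ideal_set I" "monomial ` A \<subseteq> I" for I :: "('n, 'k) mpoly set"
    proof -
    have "Poly_Mapping.single b c \<in> I" if b: "lookup b \<in> ?U" for b and c :: 'k
    proof -
      obtain a where a: "a \<in> A" "lookup a \<le> lookup b" using b by auto
      then have "b = (b - a) + a" using exponent_add_diff[OF a(2)] by (simp add: add.commute)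
      then have "Poly_Mapping.single b c = Poly_Mapping.single (b - a) c * monomial a"
        by (simp add: monomial_def mult_single)
      then show ?thesis using I a by (auto simp: ideal_set_closed)
    qed
    then have "(\<Sum>a\<in>keys f. Poly_Mapping.single a (lookup f a)) \<in> I"
      using f by (intro ideal_set_sum[OF I(1)]) (auto simp: polys_on_def)
    then show "f \<in> I" using poly_mapping_sum_single[of f] by simp
    qed
    then show "f \<in> genideal mpoly_ring (monomial ` A)"
      unfolding genideal_ring_of_type by blast
  qed
qed

lemma genideal_finite_combination:
  fixes A :: "'a::comm_ring_1 set"
  assumes "finite A" "x \<in> genideal ring_of_type_algebra A"
  shows "\<exists>r. x = (\<Sum>a\<in>A. r a * a)"
proof -
  let ?I = "{x. \<exists>r. x = (\<Sum>a\<in>A. r a * a)}"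
  have "ideal_set ?I"
    unfolding ideal_set_def
  proof (intro conjI ballI allI)
    show "0 \<in> ?I" by (auto intro!: exI[of _ "\<lambda>_. 0"])
  next
    fix x y assume "x \<in> ?I" "y \<in> ?I"
    then obtain r s where "x = (\<Sum>a\<in>A. r a * a)" "y = (\<Sum>a\<in>A. s a * a)" by auto
    then have "x + y = (\<Sum>a\<in>A. (r a + s a) * a)" by (simp add: sum.distrib distrib_right)
    then show "x + y \<in> ?I" by (intro CollectI exI)
  next
    fix x t assume "x \<in> ?I"
    then obtain r where "x = (\<Sum>a\<in>A. r a * a)" by auto
    then have "t * x = (\<Sum>a\<in>A. (t * r a) * a)" by (simp add: sum_distrib_left mult.assoc)
    then show "t * x \<in> ?I" by (intro CollectI exI)
  qed
  moreover have "A \<subseteq> ?I"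
  proof
    fix b assume "b \<in> A"
    have "(\<Sum>a\<in>A. (if a = b then 1 else 0) * a) = (\<Sum>a\<in>A. if a = b then a else 0)"
      by (intro sum.cong) auto
    also have "\<dots> = b" using \<open>b \<in> A\<close> assms(1) by simp
    finally have "b = (\<Sum>a\<in>A. (if a = b then 1 else 0) * a)" by simp
    then show "b \<in> ?I" by (intro CollectI exI)
  qed
  ultimately have "genideal ring_of_type_algebra A \<subseteq> ?I"
    unfolding genideal_ring_of_type by (intro Inter_lower) simp
  then show ?thesis using assms(2) by blast
qed

section \<open>The number of generators of a monomial ideal\<close>

text \<open>
  A homogeneous linear system with more unknowns (\<open>B\<close>) than equations (\<open>A\<close>) has a nontrivial
  solution; one equation and one unknown are eliminated at a time.
\<close>

lemma underdetermined_system: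
  fixes m :: "'a \<Rightarrow> 'b \<Rightarrow> 'k::field"
  assumes "finite A" "finite B" "card A < card B"
  shows "\<exists>y. (\<exists>b\<in>B. y b \<noteq> 0) \<and> (\<forall>a\<in>A. (\<Sum>b\<in>B. m a b * y b) = 0)"
  using assms
proof (induction A arbitrary: B m rule: finite_induct)
  case empty
  then have "B \<noteq> {}" by auto
  then show ?case by (intro exI[of _ "\<lambda>_. 1"]) auto
next
  case (insert a A)
  show ?case
  proof (cases "\<forall>b\<in>B. m a b = 0")
    case True
    obtain y where "\<exists>b\<in>B. y b \<noteq> 0" "\<forall>a\<in>A. (\<Sum>b\<in>B. m a b * y b) = 0"
      using insert.IH[of B m] insert.prems insert.hyps by auto
    moreover have "(\<Sum>b\<in>B. m a b * y b) = 0" using True by (intro sum.neutral) simp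
    ultimately show ?thesis by (intro exI[of _ y]) simp
  next
    case False
    then obtain p where p: "p \<in> B" "m a p \<noteq> 0" by auto
    let ?B = "B - {p}"
    let ?m = "\<lambda>c b. m c b - m c p * m a b / m a p"
    have "card A < card ?B" using insert.prems insert.hyps p(1) by simp
    then obtain y where y: "\<exists>b\<in>?B. y b \<noteq> 0" "\<forall>c\<in>A. (\<Sum>b\<in>?B. ?m c b * y b) = 0"
      using insert.IH[of ?B ?m] insert.prems by auto
    let ?s = "\<Sum>b\<in>?B. m a b * y b"
    let ?y = "y(p := - ?s / m a p)"
    have expand: "(\<Sum>b\<in>B. m c b * ?y b) = (\<Sum>b\<in>?B. ?m c b * y b)" for c
    proof -
      have "(\<Sum>b\<in>B. m c b * ?y b) = m c p * ?y p + (\<Sum>b\<in>?B. m c b * ?y b)"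
        using insert.prems(1) p(1) by (rule sum.remove)
      also have "(\<Sum>b\<in>?B. m c b * ?y b) = (\<Sum>b\<in>?B. m c b * y b)"
        by (intro sum.cong) auto
      also have "(\<Sum>b\<in>?B. ?m c b * y b) = (\<Sum>b\<in>?B. m c b * y b) - m c p / m a p * ?s"
        by (simp add: sum_subtractf[symmetric] sum_distrib_left algebra_simps)
      ultimately show ?thesis by simp
    qed
    have "(\<Sum>b\<in>?B. ?m a b * y b) = 0" using p(2) by (intro sum.neutral) simp
    then have "\<forall>c\<in>insert a A. (\<Sum>b\<in>B. m c b * ?y b) = 0"
      using y(2) unfolding expand by simp
    moreover have "\<exists>b\<in>B. ?y b \<noteq> 0" using y(1) by auto
    ultimately show ?thesis by blast
  qed
qed

definition minimal_elements :: "('n \<Rightarrow> nat) set \<Rightarrow> ('n \<Rightarrow> nat) set" where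
  "minimal_elements U = {u\<in>U. \<forall>v\<in>U. v \<le> u \<longrightarrow> v = u}"

lemma minimal_element_below:
  fixes U :: "('n::finite \<Rightarrow> nat) set"
  assumes "u \<in> U"
  shows "\<exists>g\<in>minimal_elements U. g \<le> u"
  using assms
proof (induction "sum u UNIV" arbitrary: u rule: less_induct)
  case less
  show ?case
  proof (cases "u \<in> minimal_elements U")
    case False
    then obtain v where v: "v \<in> U" "v \<le> u" "v \<noteq> u"
      using less.prems by (auto simp: minimal_elements_def)
    then obtain i where "v i < u i" by (auto simp: le_fun_def fun_eq_iff order.order_iff_strict)
    then have "sum v UNIV < sum u UNIV"
      using v(2) by (intro sum_strict_mono_ex1) (auto simp: le_fun_def)
    then obtain g where "g \<in> minimal_elements U" "g \<le> v" using less.hyps v(1) by blast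
    then show ?thesis using v(2) order_trans by blast
  qed auto
qed

lemma upset_minimal_elements:
  fixes U :: "('n::finite \<Rightarrow> nat) set"
  assumes "upset U"
  shows "U = {u. \<exists>g\<in>minimal_elements U. g \<le> u}"
proof -
  have "minimal_elements U \<subseteq> U" by (auto simp: minimal_elements_def)
  then show ?thesis using minimal_element_below upsetD[OF assms] by blast
qed

text \<open>
  A proper divisor of a minimal exponent lies outside \<open>U\<close>, so only the constant term of the
  multiplier contributes.
\<close>

lemma lookup_mult_minimal:
  fixes f r :: "('n::finite, 'k::field) mpoly"
  assumes f: "f \<in> polys_on U" and u: "u \<in> minimal_elements U"
  shows "lookup (r * f) (expo u) = lookup r 0 * lookup f (expo u)"
proof -
  have "lookup (r * f) (expo u) = (\<Sum>a\<in>keys r. if a = 0 then lookup r 0 * lookup f (expo u) else 0)"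
    unfolding lookup_mult_sum
  proof (rule sum.cong)
    fix a assume "a \<in> keys r"
    show "(if lookup a \<le> lookup (expo u) then lookup r a * lookup f (expo u - a) else 0) =
      (if a = 0 then lookup r 0 * lookup f (expo u) else 0)"
    proof (cases "a = 0 \<or> \<not> lookup a \<le> u")
      case True
      then show ?thesis by (auto simp: le_fun_def)
    next
      case False
      then have "lookup (expo u - a) \<le> u" by (simp add: le_fun_def lookup_minus)
      moreover have "\<exists>i. lookup a i \<noteq> 0"
        using False by (auto simp: poly_mapping_eq_iff fun_eq_iff)
      then obtain i where "lookup a i > 0" by auto
      then have "lookup (expo u - a) i < u i"
        using False le_funD[of "lookup a" u i] by (simp add: lookup_minus)
      then have "lookup (expo u - a) \<noteq> u" by auto
      ultimately have "lookup (expo u - a) \<notin> U" using u by (auto simp: minimal_elements_def)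
      then have "lookup f (expo u - a) = 0" using f by (simp add: polys_on_iff)
      then show ?thesis using False by simp
    qed
  qed simp
  also have "\<dots> = lookup r 0 * lookup f (expo u)" by (simp add: in_keys_iff)
  finally show ?thesis .
qed

text \<open>
  Reading off the coefficients at the minimal exponents maps \<open>polys_on U\<close> onto a space of
  dimension \<open>card (minimal_elements U)\<close>. By the preceding lemma this factors through constant
  coefficients, so that the image is spanned by the images of the generators.
\<close>

lemma card_minimal_elements_le:
  fixes A :: "('n::finite, 'k::field) mpoly set"
  assumes "finite A" and gen: "genideal mpoly_ring A = polys_on U"
  shows "finite (minimal_elements U)" "card (minimal_elements U) \<le> card A"
proof -
  have bound: "card B \<le> card A" if B: "finite B" "B \<subseteq> minimal_elements U" for B
  proof (rule ccontr)
    assume "\<not> card B \<le> card A"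
    then have "card A < card B" by simp
    \<comment> \<open>a linear form on the coefficients that vanishes on all generators but not on the ideal\<close>
    then obtain y where y: "\<exists>u\<in>B. y u \<noteq> 0" "\<And>a. a \<in> A \<Longrightarrow> (\<Sum>u\<in>B. lookup a (expo u) * y u) = 0"
      using underdetermined_system[OF assms(1) B(1), of "\<lambda>a u. lookup a (expo u)"] by blast
    obtain u0 where u0: "u0 \<in> B" "y u0 \<noteq> 0" using y(1) by blast
    have "A \<subseteq> polys_on U" unfolding gen[symmetric] genideal_ring_of_type by blast
    have "u0 \<in> U" using u0 B by (auto simp: minimal_elements_def)
    then have "monomial (expo u0) \<in> genideal mpoly_ring A" unfolding gen by simp
    then obtain r where r: "monomial (expo u0) = (\<Sum>a\<in>A. r a * a)"
      using genideal_finite_combination[OF assms(1)] by blast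
    have "y u0 = (\<Sum>u\<in>B. lookup (monomial (expo u0) :: ('n, 'k) mpoly) (expo u) * y u)"
      using u0 B by (simp add: monomial_def lookup_single when_def if_distrib[of "\<lambda>x. x * _"] cong: if_cong)
    also have "\<dots> = (\<Sum>u\<in>B. \<Sum>a\<in>A. lookup (r a) 0 * (lookup a (expo u) * y u))"
    proof (intro sum.cong refl)
      fix u assume "u \<in> B"
      have "lookup (\<Sum>a\<in>A. r a * a) (expo u) = (\<Sum>a\<in>A. lookup (r a) 0 * lookup a (expo u))"
        using \<open>A \<subseteq> polys_on U\<close> \<open>u \<in> B\<close> B(2)
        by (auto simp: lookup_sum intro!: sum.cong lookup_mult_minimal)
      then show "lookup (monomial (expo u0)) (expo u) * y u =
          (\<Sum>a\<in>A. lookup (r a) 0 * (lookup a (expo u) * y u))"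
        unfolding r by (simp add: sum_distrib_right mult.assoc)
    qed
    also have "\<dots> = (\<Sum>a\<in>A. lookup (r a) 0 * (\<Sum>u\<in>B. lookup a (expo u) * y u))"
      by (subst sum.swap) (simp add: sum_distrib_left)
    also have "\<dots> = 0" using y(2) by simp
    finally show False using u0 by simp
  qed
  show fin: "finite (minimal_elements U)"
  proof (rule ccontr)
    assume "infinite (minimal_elements U)"
    then obtain B where "finite B" "card B = Suc (card A)" "B \<subseteq> minimal_elements U"
      by (meson infinite_arbitrarily_large)
    then show False using bound by fastforce
  qed
  show "card (minimal_elements U) \<le> card A" using bound[OF fin] by simp
qed

section \<open>The height of a prime generated by variables\<close>

definition prime_set :: "'a::comm_ring_1 set \<Rightarrow> bool" where
  "prime_set P \<longleftrightarrow> ideal_set P \<and> P \<noteq> UNIV \<and> (\<forall>x y. x * y \<in> P \<longrightarrow> x \<in> P \<or> y \<in> P)"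

lemma prime_set_ideal: "prime_set P \<Longrightarrow> ideal_set P"
  by (simp add: prime_set_def)

lemma primeideal_ring_of_type_iff:
  "primeideal P (ring_of_type_algebra :: 'a::comm_ring_1 ring) \<longleftrightarrow> prime_set P"
proof
  assume "primeideal P (ring_of_type_algebra :: 'a ring)"
  then interpret primeideal P "ring_of_type_algebra :: 'a ring" .
  show "prime_set P"
    using I_prime I_notcarr is_ideal by (auto simp: prime_set_def ideal_ring_of_type_iff)
next
  assume P: "prime_set P"
  show "primeideal P (ring_of_type_algebra :: 'a ring)"
    by (rule primeidealI)
       (use P in \<open>auto simp: prime_set_def ideal_ring_of_type_iff intro: cring_from_type_algebra\<close>)
qed

definition var_ideal :: "'n::finite set \<Rightarrow> ('n, 'k::field) mpoly set" where
  "var_ideal Z = polys_on {u. \<exists>i\<in>Z. 0 < u i}"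

text \<open>
  The index type carries no order. Numbering the variables embeds the exponents into \<open>nat \<Rightarrow>\<^sub>0
  nat\<close>, which is linearly ordered compatibly with addition.
\<close>

lemma additive_ordering:
  "\<exists>\<phi> :: ('n::finite \<Rightarrow>\<^sub>0 nat) \<Rightarrow> (nat \<Rightarrow>\<^sub>0 nat). inj \<phi> \<and> (\<forall>a b. \<phi> (a + b) = \<phi> a + \<phi> b)"
proof -
  obtain e :: "'n \<Rightarrow> nat" where e: "inj e"
    using finite_imp_inj_to_nat_seg[of "UNIV :: 'n set"] by auto
  define \<phi> :: "('n \<Rightarrow>\<^sub>0 nat) \<Rightarrow> (nat \<Rightarrow>\<^sub>0 nat)" where
    "\<phi> a = (\<Sum>i\<in>UNIV. Poly_Mapping.single (e i) (lookup a i))" for a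
  have "lookup (\<phi> a) (e i) = lookup a i" for a i
  proof -
    have "lookup (\<phi> a) (e i) = (\<Sum>j\<in>UNIV. if j = i then lookup a j else 0)"
      unfolding \<phi>_def lookup_sum
      by (intro sum.cong) (auto simp: lookup_single when_def injD[OF e])
    then show ?thesis by simp
  qed
  then have "a = b" if "\<phi> a = \<phi> b" for a b
    using that by (intro poly_mapping_eqI) metis
  then have "inj \<phi>" by (rule injI)
  moreover have "\<phi> (a + b) = \<phi> a + \<phi> b" for a b
    by (simp add: \<phi>_def lookup_add single_add sum.distrib)
  ultimately show ?thesis by blast
qed

text \<open>
  If neither factor lies in the ideal, each has a largest exponent, with respect to an
  additive linear order, among those that are free of the variables in \<open>Z\<close>. At the sum of
  these two exponents the product has a nonzero coefficient.
\<close>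

lemma prime_var_ideal: "prime_set (var_ideal Z :: ('n::finite, 'k::field) mpoly set)"
proof -
  let ?U = "{u::'n \<Rightarrow> nat. \<exists>i\<in>Z. 0 < u i}"
  have "upset ?U" by (auto simp: upset_def le_fun_def intro: less_le_trans)
  then have "ideal_set (var_ideal Z :: ('n, 'k) mpoly set)"
    unfolding var_ideal_def by (rule ideal_set_polys_on)
  moreover have "(1 :: ('n, 'k) mpoly) \<notin> var_ideal Z"
    by (simp add: var_ideal_def polys_on_iff lookup_one when_def exI[of _ 0])
  moreover have "f * g \<notin> var_ideal Z" if f: "f \<notin> var_ideal Z" and g: "g \<notin> var_ideal Z"
    for f g :: "('n, 'k) mpoly"
  proof -
    obtain \<phi> :: "('n \<Rightarrow>\<^sub>0 nat) \<Rightarrow> (nat \<Rightarrow>\<^sub>0 nat)"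
      where \<phi>: "inj \<phi>" "\<And>a b. \<phi> (a + b) = \<phi> a + \<phi> b" using additive_ordering by blast
    let ?K = "\<lambda>h :: ('n, 'k) mpoly. {a \<in> keys h. lookup a \<notin> ?U}"
    have ex: "\<exists>a\<in>?K h. \<forall>b\<in>?K h. \<phi> b \<le> \<phi> a" if "h \<notin> var_ideal Z" for h :: "('n, 'k) mpoly"
    proof -
      have "?K h \<noteq> {}" "finite (?K h)" using that by (auto simp: var_ideal_def polys_on_def)
      then have "Max (\<phi> ` ?K h) \<in> \<phi> ` ?K h" "\<forall>b\<in>?K h. \<phi> b \<le> Max (\<phi> ` ?K h)"
        by (auto intro!: Max_in Max_ge)
      then show ?thesis by (smt (verit) imageE)
    qed
    obtain a where a: "a \<in> ?K f" "\<And>b. b \<in> ?K f \<Longrightarrow> \<phi> b \<le> \<phi> a" using ex[OF f] by blast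
    obtain b where b: "b \<in> ?K g" "\<And>a. a \<in> ?K g \<Longrightarrow> \<phi> a \<le> \<phi> b" using ex[OF g] by blast
    have ab: "lookup (a + b) \<notin> ?U" using a(1) b(1) by (auto simp: lookup_add)
    have "lookup (f * g) (a + b) = (\<Sum>c\<in>keys f. if c = a then lookup f a * lookup g b else 0)"
      unfolding lookup_mult_sum
    proof (intro sum.cong refl)
      fix c assume c: "c \<in> keys f"
      show "(if lookup c \<le> lookup (a + b) then lookup f c * lookup g (a + b - c) else 0) =
        (if c = a then lookup f a * lookup g b else 0)"
      proof (cases "c = a")
        case True
        then show ?thesis by (simp add: lookup_add le_fun_def)
      next
        case False
        have "lookup g (a + b - c) = 0" if le: "lookup c \<le> lookup (a + b)"
        proof (rule ccontr)
          assume "lookup g (a + b - c) \<noteq> 0"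
          then have d: "a + b - c \<in> keys g" by (simp add: in_keys_iff)
          have "lookup (a + b - c) \<notin> ?U" using ab by (auto simp: lookup_minus lookup_add)
          then have "\<phi> (a + b - c) \<le> \<phi> b" using b(2) d by blast
          moreover have "lookup c \<notin> ?U"
          proof
            assume "lookup c \<in> ?U"
            then obtain i where "i \<in> Z" "0 < lookup c i" by auto
            then have "0 < lookup (a + b) i" using le_funD[OF le, of i] by simp
            then show False using ab \<open>i \<in> Z\<close> by auto
          qed
          then have "\<phi> c \<le> \<phi> a" using a(2) c by blast
          moreover have "\<phi> c + \<phi> (a + b - c) = \<phi> a + \<phi> b"
            using exponent_add_diff[OF le] \<phi>(2) by metis
          ultimately have "\<phi> c = \<phi> a"
            by (metis add_less_le_mono le_imp_less_or_eq less_irrefl)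
          then show False using \<phi>(1) False by (simp add: inj_eq)
        qed
        then show ?thesis using False by simp
      qed
    qed
    also have "\<dots> = lookup f a * lookup g b" using a(1) by simp
    also have "\<dots> \<noteq> 0" using a(1) b(1) by (simp add: in_keys_iff)
    finally show ?thesis using ab unfolding var_ideal_def polys_on_iff by blast
  qed
  ultimately show ?thesis unfolding prime_set_def by blast
qed

fun list_monomial :: "'a::comm_ring_1 list \<Rightarrow> nat list \<Rightarrow> 'a" where
  "list_monomial (f # fs) (e # es) = f ^ e * list_monomial fs es"
| "list_monomial _ _ = 1"

text \<open>
  Algebraic independence of \<open>fs\<close> over \<open>A\<close> modulo \<open>P\<close>: no nontrivial polynomial expression in
  \<open>fs\<close> with coefficients in \<open>A\<close> lies in \<open>P\<close>. The exponent vectors are lists, parallel to \<open>fs\<close>.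
\<close>

definition alg_indep_mod :: "'a::comm_ring_1 set \<Rightarrow> 'a set \<Rightarrow> 'a list \<Rightarrow> bool" where
  "alg_indep_mod A P fs \<longleftrightarrow>
     (\<forall>E a. finite E \<longrightarrow> (\<forall>e\<in>E. length e = length fs \<and> a e \<in> A) \<longrightarrow>
        (\<Sum>e\<in>E. a e * list_monomial fs e) \<in> P \<longrightarrow> (\<forall>e\<in>E. a e = 0))"

lemma sum_split_by:
  "finite E \<Longrightarrow> sum t E = sum t {e \<in> E. P e} + sum t {e \<in> E. \<not> P e}"
  by (subst sum.union_disjoint[symmetric]) (auto intro: sum.cong)

text \<open>
  Suppose that a polynomial expression lies in \<open>Q\<close>, and let \<open>f\<^sup>m\<close> be the largest power of \<open>f\<close>
  that can be cancelled from it. As \<open>Q\<close> is prime and \<open>f \<notin> Q\<close>, the expression divided by \<open>f\<^sup>m\<close>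
  still lies in \<open>Q \<subseteq> Q'\<close>. Since \<open>f \<in> Q'\<close>, the terms that are free of \<open>f\<close> then form an
  expression in \<open>Q'\<close>, to which the independence modulo \<open>Q'\<close> applies.
\<close>

lemma alg_indep_mod_Cons:
  assumes Q: "prime_set Q" and Q': "ideal_set Q'" and sub: "Q \<subseteq> Q'"
    and f: "f \<in> Q'" "f \<notin> Q" and indep: "alg_indep_mod A Q' fs"
  shows "alg_indep_mod A Q (f # fs)"
  unfolding alg_indep_mod_def
proof (intro allI impI ballI, rule ccontr)
  fix E a e0
  assume E: "finite E" "\<forall>e\<in>E. length e = length (f # fs) \<and> a e \<in> A"
    and sum: "(\<Sum>e\<in>E. a e * list_monomial (f # fs) e) \<in> Q" and e0: "e0 \<in> E" "a e0 \<noteq> 0"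
  have Qi: "ideal_set Q" and Qp: "x * y \<in> Q \<Longrightarrow> x \<notin> Q \<Longrightarrow> y \<in> Q" for x y
    using Q by (auto simp: prime_set_def)
  let ?E = "{e \<in> E. a e \<noteq> 0}"
  let ?m = "Min (hd ` ?E)"
  let ?t = "\<lambda>e. a e * (f ^ (hd e - ?m) * list_monomial fs (tl e))"
  have finE: "finite ?E" using E(1) by simp
  have m_le: "?m \<le> hd e" if "e \<in> ?E" for e using that finE by (intro Min_le) auto
  have Cons: "hd e # tl e = e" "length (tl e) = length fs" if "e \<in> ?E" for e
    using that E(2) by (cases e; auto)+
  have "(\<Sum>e\<in>E. a e * list_monomial (f # fs) e) = (\<Sum>e\<in>?E. a e * list_monomial (f # fs) e)"
    using E(1) by (intro sum.mono_neutral_right) auto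
  also have "\<dots> = (\<Sum>e\<in>?E. f ^ ?m * ?t e)"
  proof (intro sum.cong refl)
    fix e assume e: "e \<in> ?E"
    have "list_monomial (f # fs) e = f ^ hd e * list_monomial fs (tl e)"
      using Cons[OF e] list_monomial.simps(1)[of f fs "hd e" "tl e"] by simp
    also have "f ^ hd e = f ^ ?m * f ^ (hd e - ?m)"
      using m_le[OF e] by (simp add: power_add[symmetric])
    finally show "a e * list_monomial (f # fs) e = f ^ ?m * ?t e" by (simp add: ac_simps)
  qed
  also have "\<dots> = f ^ ?m * (\<Sum>e\<in>?E. ?t e)" by (simp add: sum_distrib_left)
  finally have "f ^ ?m * (\<Sum>e\<in>?E. ?t e) \<in> Q" using sum by simp
  moreover have "f ^ k \<notin> Q" for k
  proof (induction k)
    case 0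
    have "1 \<notin> Q" using Q ideal_set_closed(3)[OF Qi, of 1] by (auto simp: prime_set_def)
    then show ?case by simp
  next
    case (Suc k)
    then show ?case using Qp[of f "f ^ k"] f(2) by auto
  qed
  ultimately have "(\<Sum>e\<in>?E. ?t e) \<in> Q'" using Qp sub by blast
  moreover have "(\<Sum>e\<in>{e\<in>?E. hd e \<noteq> ?m}. ?t e) \<in> Q'"
  proof (rule ideal_set_sum[OF Q'])
    fix e assume e: "e \<in> {e\<in>?E. hd e \<noteq> ?m}"
    then have "0 < hd e - ?m" using m_le[of e] by auto
    then obtain k where "hd e - ?m = Suc k" by (meson gr0_implies_Suc)
    then have "?t e = a e * f ^ k * list_monomial fs (tl e) * f" by (simp add: ac_simps)
    then show "?t e \<in> Q'" using ideal_set_closed(3)[OF Q' f(1)] by simp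
  qed
  moreover have "(\<Sum>e\<in>?E. ?t e) =
      (\<Sum>e\<in>{e\<in>?E. hd e = ?m}. ?t e) + (\<Sum>e\<in>{e\<in>?E. hd e \<noteq> ?m}. ?t e)"
    by (rule sum_split_by[OF finE])
  ultimately have "(\<Sum>e\<in>{e\<in>?E. hd e = ?m}. ?t e) \<in> Q'"
    using ideal_set_closed(6)[OF Q'] by fastforce
  also have "(\<Sum>e\<in>{e\<in>?E. hd e = ?m}. ?t e) =
      (\<Sum>e\<in>tl ` {e\<in>?E. hd e = ?m}. a (?m # e) * list_monomial fs e)"
  proof (subst sum.reindex)
    show "inj_on tl {e\<in>?E. hd e = ?m}"
    proof (rule inj_onI)
      fix d e assume "d \<in> {e\<in>?E. hd e = ?m}" "e \<in> {e\<in>?E. hd e = ?m}" "tl d = tl e"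
      then show "d = e" using Cons(1)[of d] Cons(1)[of e] by auto
    qed
    have "a e = a (?m # tl e)" if "e \<in> {e\<in>?E. hd e = ?m}" for e
      using that Cons(1)[of e] by auto
    then show "(\<Sum>e\<in>{e\<in>?E. hd e = ?m}. ?t e) =
      sum ((\<lambda>e. a (?m # e) * list_monomial fs e) \<circ> tl) {e\<in>?E. hd e = ?m}"
      by (intro sum.cong) auto
  qed
  finally have S: "(\<Sum>e\<in>tl ` {e\<in>?E. hd e = ?m}. a (?m # e) * list_monomial fs e) \<in> Q'" .
  have L: "\<forall>e\<in>tl ` {e\<in>?E. hd e = ?m}. length e = length fs \<and> a (?m # e) \<in> A"
  proof
    fix e assume "e \<in> tl ` {e\<in>?E. hd e = ?m}"
    then obtain d where d: "d \<in> ?E" "hd d = ?m" "e = tl d" by auto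
    then have "?m # e = d" using Cons(1)[of d] by simp
    then show "length e = length fs \<and> a (?m # e) \<in> A" using d Cons(2)[of d] E(2) by auto
  qed
  have "finite (tl ` {e\<in>?E. hd e = ?m})"
    by (rule finite_imageI, rule finite_subset[OF _ finE]) blast
  then have zero: "\<forall>e\<in>tl ` {e\<in>?E. hd e = ?m}. a (?m # e) = 0"
    using indep[unfolded alg_indep_mod_def, rule_format, where E = "tl ` {e\<in>?E. hd e = ?m}"
        and a = "\<lambda>e. a (?m # e)"] L S by blast
  have "?m \<in> hd ` ?E" using e0 finE by (intro Min_in) auto
  then obtain d where d: "d \<in> ?E" "hd d = ?m" by auto
  then have "a (?m # tl d) = 0" using zero by blast
  moreover have "?m # tl d = d" using Cons(1)[OF d(1)] d(2) by simp
  ultimately show False using d(1) by simp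
qed

text \<open>
  The lower bound that a chain of primes gives for the transcendence degree (Coquand and
  Lombardi): picking one element from each step of the chain yields algebraically independent
  elements. They remain so over any set of coefficients that meets the largest prime only in
  \<open>0\<close>.
\<close>

lemma prime_chain_alg_indep:
  fixes A :: "'a::comm_ring_1 set"
  assumes "sorted_wrt (\<subset>) (Ps @ [P])" "\<forall>Q\<in>set (Ps @ [P]). prime_set Q" "A \<inter> P \<subseteq> {0}"
  shows "\<exists>fs. length fs = length Ps \<and> alg_indep_mod A (hd (Ps @ [P])) fs"
  using assms(1,2)
proof (induction Ps)
  case Nil
  have key: "a e = 0" if "\<forall>e\<in>E. length e = 0 \<and> a e \<in> A" "(\<Sum>e\<in>E. a e * list_monomial [] e) \<in> P" "e \<in> E"
    for E a and e :: "nat list"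
  proof -
    have "E = {[]}" using that(1,3) by auto
    then have "a [] \<in> A \<inter> P" "e = []" using that by auto
    then show ?thesis using assms(3) by auto
  qed
  have "alg_indep_mod A P []"
    unfolding alg_indep_mod_def
  proof (intro allI impI ballI)
    fix E a and e :: "nat list"
    assume "\<forall>e\<in>E. length e = length ([] :: 'a list) \<and> a e \<in> A"
      "(\<Sum>e\<in>E. a e * list_monomial [] e) \<in> P" "e \<in> E"
    then show "a e = 0" by (intro key) simp_all
  qed
  then show ?case by (intro exI[of _ "[]"]) simp
next
  case (Cons Q Ps)
  let ?Q' = "hd (Ps @ [P])"
  obtain fs where fs: "length fs = length Ps" "alg_indep_mod A ?Q' fs" using Cons by auto
  have "?Q' \<in> set (Ps @ [P])" by (cases Ps) auto
  then have "Q \<subset> ?Q'" "ideal_set ?Q'" using Cons.prems prime_set_ideal[of ?Q'] by auto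
  then obtain f where "f \<in> ?Q'" "f \<notin> Q" "Q \<subseteq> ?Q'" by blast
  moreover have "prime_set Q" using Cons.prems by simp
  ultimately have "alg_indep_mod A Q (f # fs)"
    using alg_indep_mod_Cons \<open>ideal_set ?Q'\<close> fs(2) by blast
  then show ?case using fs(1) by (intro exI[of _ "f # fs"]) simp
qed

abbreviation degrees_le :: "nat \<Rightarrow> ('n::finite, 'k::field) mpoly set" where
  "degrees_le d \<equiv> polys_on {u. \<forall>i. u i \<le> d}"

lemma degrees_le_mono: "f \<in> degrees_le d \<Longrightarrow> d \<le> d' \<Longrightarrow> f \<in> degrees_le d'"
  using polys_on_mono[of "{u. \<forall>i. u i \<le> d}" "{u. \<forall>i. u i \<le> d'}"] order_trans by blast

lemma degrees_le_mult:
  assumes "f \<in> degrees_le d" "g \<in> degrees_le d'"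
  shows "f * g \<in> degrees_le (d + d')"
  unfolding polys_on_def
proof (intro CollectI ballI allI)
  fix c i assume "c \<in> keys (f * g)"
  then obtain a b where "a \<in> keys f" "b \<in> keys g" "c = a + b"
    using keys_mult[of f g] by auto
  then show "lookup c i \<le> d + d'"
    using assms by (auto simp: polys_on_def lookup_add intro!: add_mono)
qed

lemma one_in_polys_on [simp]:
  "(1 :: ('n::finite, 'k::field) mpoly) \<in> polys_on U \<longleftrightarrow> (\<lambda>_. 0) \<in> U"
proof -
  have "lookup (0 :: 'n \<Rightarrow>\<^sub>0 nat) = (\<lambda>_. 0)" by auto
  then show ?thesis by (simp add: polys_on_def)
qed

lemma degrees_le_power: "f \<in> degrees_le d \<Longrightarrow> f ^ k \<in> degrees_le (k * d)"
  by (induction k) (auto intro: degrees_le_mult)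

lemma degrees_le_exists: "\<exists>d. f \<in> degrees_le d"
proof -
  have "lookup a i \<le> Max (insert 0 ((\<lambda>(a, i). lookup a i) ` (keys f \<times> UNIV)))" if "a \<in> keys f" for a i
    using that by (intro Max_ge) auto
  then show ?thesis by (intro exI) (auto simp: polys_on_def)
qed

lemma degrees_le_list_monomial:
  assumes "\<forall>f\<in>set fs. f \<in> degrees_le d" "\<forall>k\<in>set e. k \<le> s" "length e = length fs"
  shows "list_monomial fs e \<in> degrees_le (length fs * (s * d))"
  using assms
proof (induction fs e rule: list_monomial.induct)
  case (1 f fs k e)
  have "f ^ k \<in> degrees_le (s * d)"
    using 1(2,3) by (auto intro: degrees_le_mono[OF degrees_le_power])
  then show ?case using 1 by (auto intro: degrees_le_mult)
qed auto

lemma degrees_le_common: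
  fixes fs :: "('n::finite, 'k::field) mpoly list"
  shows "\<exists>d. \<forall>f\<in>set fs. f \<in> degrees_le d"
proof (induction fs)
  case (Cons f fs)
  then obtain d where "\<forall>f\<in>set fs. f \<in> degrees_le d" by blast
  moreover obtain d' where "f \<in> degrees_le d'" using degrees_le_exists by blast
  ultimately show ?case
    by (intro exI[of _ "max d d'"]) (auto intro: degrees_le_mono)
qed simp

lemma card_bounded_exponents:
  "card {b :: 'n::finite \<Rightarrow> nat. (\<forall>i. b i < s) \<and> (\<forall>i\<in>Z. b i = 0)} = s ^ (CARD('n) - card Z)"
  if "0 < s"
proof -
  have "{b :: 'n \<Rightarrow> nat. (\<forall>i. b i < s) \<and> (\<forall>i\<in>Z. b i = 0)} =
      (\<Pi>\<^sub>E i\<in>UNIV. if i \<in> Z then {0} else {..<s})"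
  proof -
    have "b i < s \<and> (i \<in> Z \<longrightarrow> b i = 0) \<longleftrightarrow> b i \<in> (if i \<in> Z then {0} else {..<s})" for b :: "'n \<Rightarrow> nat" and i
      using that by auto
    then have "{b :: 'n \<Rightarrow> nat. (\<forall>i. b i < s) \<and> (\<forall>i\<in>Z. b i = 0)} =
        {b. \<forall>i. b i \<in> (if i \<in> Z then {0} else {..<s})}" by blast
    then show ?thesis by (simp add: PiE_UNIV_domain Pi_def)
  qed
  then have "card {b :: 'n \<Rightarrow> nat. (\<forall>i. b i < s) \<and> (\<forall>i\<in>Z. b i = 0)} =
      (\<Prod>i\<in>UNIV. if i \<in> Z then 1 else s)"
    by (simp add: card_PiE if_distrib[of card] cong: if_cong)
  also have "\<dots> = (\<Prod>i\<in>-Z. s)"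
    by (intro prod.mono_neutral_cong_right) auto
  also have "\<dots> = s ^ (CARD('n) - card Z)" by (simp add: Compl_eq_Diff_UNIV card_Diff_subset)
  finally show ?thesis .
qed

text \<open>
  Together with the variables outside \<open>Z\<close> there are more than \<open>n\<close> elements, so they must be
  dependent. The products of powers below \<open>s\<close> of these elements number at least \<open>s\<^sup>n\<^sup>+\<^sup>1\<close>, but
  have degree less than \<open>s M\<close> in each variable, and \<open>(s M)\<^sup>n < s\<^sup>n\<^sup>+\<^sup>1\<close> for \<open>s > M\<^sup>n\<close>. Hence
  they are linearly dependent, and the relation can be sorted by the exponents of \<open>fs\<close>.
\<close>

lemma not_alg_indep:
  fixes fs :: "('n::finite, 'k::field) mpoly list"
  assumes "card Z < length fs" "ideal_set Q"
  shows "\<not> alg_indep_mod (polys_on {u. \<forall>i\<in>Z. u i = 0}) Q fs"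
proof
  let ?A = "polys_on {u. \<forall>i\<in>Z. u i = 0} :: ('n, 'k) mpoly set"
  assume indep: "alg_indep_mod ?A Q fs"
  obtain d where d: "\<forall>f\<in>set fs. f \<in> degrees_le d" using degrees_le_common by blast
  define M where "M = 1 + length fs * d"
  define s where "s = M ^ CARD('n) + 1"
  have s: "0 < s" by (simp add: s_def)
  let ?B = "{b :: 'n \<Rightarrow> nat. (\<forall>i. b i < s) \<and> (\<forall>i\<in>Z. b i = 0)}"
  let ?E = "{e. set e \<subseteq> {..<s} \<and> length e = length fs}"
  let ?C = "{b :: 'n \<Rightarrow> nat. \<forall>i. b i < s * M}"
  have cC: "card ?C = (s * M) ^ CARD('n)"
    using card_bounded_exponents[of "s * M" "{} :: 'n set"] s by (simp add: M_def)
  have cB: "card ?B = s ^ (CARD('n) - card Z)" by (rule card_bounded_exponents[OF s])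
  have cE: "card ?E = s ^ length fs" by (simp add: card_lists_length_eq)
  have fin: "finite ?B" "finite ?C" "finite ?E"
  proof -
    show "finite ?B" by (rule card_ge_0_finite) (use cB s in simp)
    show "finite ?C" by (rule card_ge_0_finite) (use cC s in \<open>simp add: M_def\<close>)
    show "finite ?E" by (rule finite_lists_length_eq) simp
  qed
  have "(s * M) ^ CARD('n) = s ^ CARD('n) * M ^ CARD('n)" by (rule power_mult_distrib)
  also have "\<dots> < s ^ CARD('n) * s"
    using s by (intro mult_strict_left_mono) (simp_all add: s_def)
  also have "\<dots> = s ^ Suc (CARD('n))" by simp
  also have "\<dots> \<le> s ^ (CARD('n) - card Z + length fs)"
  proof (rule power_increasing)
    have "card Z \<le> CARD('n)" by (simp add: card_mono)
    then show "Suc (CARD('n)) \<le> CARD('n) - card Z + length fs" using assms(1) by simp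
  qed (use s in simp)
  finally have "card ?C < card (?B \<times> ?E)"
    unfolding cC card_cartesian_product cB cE by (simp add: power_add)
  moreover have "finite (?B \<times> ?E)" using fin by simp
  ultimately obtain y :: "('n \<Rightarrow> nat) \<times> nat list \<Rightarrow> 'k" where
    y: "\<exists>p\<in>?B \<times> ?E. y p \<noteq> 0"
      "\<And>c. c \<in> ?C \<Longrightarrow> (\<Sum>p\<in>?B \<times> ?E. lookup (monomial (expo (fst p)) * list_monomial fs (snd p)) (expo c) * y p) = 0"
    using underdetermined_system[OF fin(2), of "?B \<times> ?E"
        "\<lambda>c p. lookup (monomial (expo (fst p)) * list_monomial fs (snd p)) (expo c)"] by blast
  define a where "a e = (\<Sum>b\<in>?B. Poly_Mapping.single (expo b) (y (b, e)))" for e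
  have aA: "a e \<in> ?A" for e
    unfolding a_def by (rule polys_on_sum) (auto simp: polys_on_def split: if_splits)
  have "(\<Sum>e\<in>?E. a e * list_monomial fs e) = 0"
  proof (rule poly_mapping_eqI)
    fix c
    have "lookup (\<Sum>e\<in>?E. a e * list_monomial fs e) c =
        (\<Sum>e\<in>?E. \<Sum>b\<in>?B. lookup (Poly_Mapping.single (expo b) (y (b, e)) * list_monomial fs e) c)"
      by (simp add: lookup_sum a_def sum_distrib_right)
    also have "\<dots> = (\<Sum>e\<in>?E. \<Sum>b\<in>?B. lookup (monomial (expo b) * list_monomial fs e) c * y (b, e))"
    proof (intro sum.cong refl)
      fix e b
      show "lookup (Poly_Mapping.single (expo b) (y (b, e)) * list_monomial fs e) c =
        lookup (monomial (expo b) * list_monomial fs e) c * y (b, e)"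
        by (simp add: monomial_def lookup_single_mult)
    qed
    also have "\<dots> = (\<Sum>b\<in>?B. \<Sum>e\<in>?E. lookup (monomial (expo b) * list_monomial fs e) c * y (b, e))"
      by (rule sum.swap)
    also have "\<dots> = (\<Sum>p\<in>?B \<times> ?E. lookup (monomial (expo (fst p)) * list_monomial fs (snd p)) c * y p)"
      by (simp add: sum.cartesian_product case_prod_beta)
    also have "\<dots> = 0"
    proof (cases "lookup c \<in> ?C")
      case True
      then show ?thesis using y(2)[OF True] by simp
    next
      case False
      show ?thesis
      proof (rule sum.neutral, rule ballI)
        fix p assume p: "p \<in> ?B \<times> ?E"
        let ?f = "monomial (expo (fst p)) * list_monomial fs (snd p) :: ('n, 'k) mpoly"
        have "monomial (expo (fst p)) \<in> (degrees_le (s - 1) :: ('n, 'k) mpoly set)"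
          using p s by (auto simp: less_Suc_eq_le[symmetric])
        moreover have "list_monomial fs (snd p) \<in> degrees_le (length fs * ((s - 1) * d))"
          using p s d by (intro degrees_le_list_monomial) (auto simp: less_Suc_eq_le[symmetric])
        ultimately have "?f \<in> degrees_le ((s - 1) + length fs * ((s - 1) * d))"
          by (rule degrees_le_mult)
        moreover have "(s - 1) + length fs * ((s - 1) * d) = (s - 1) * M"
          by (simp add: M_def algebra_simps)
        moreover have "(s - 1) * M < s * M"
          by (rule mult_strict_right_mono) (use s in \<open>simp_all add: M_def\<close>)
        moreover obtain i where "s * M \<le> lookup c i" using False by (auto simp: not_less)
        ultimately have "lookup ?f c = 0"
          unfolding polys_on_iff by (metis (no_types, lifting) mem_Collect_eq not_le order_less_le_trans)
        then show "lookup ?f c * y p = 0" by simp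
      qed
    qed
    finally show "lookup (\<Sum>e\<in>?E. a e * list_monomial fs e) c = lookup 0 c" by simp
  qed
  then have "(\<Sum>e\<in>?E. a e * list_monomial fs e) \<in> Q" using assms(2) by (simp add: ideal_set_closed)
  then have zero: "\<forall>e\<in>?E. a e = 0"
    using indep[unfolded alg_indep_mod_def, rule_format, of ?E a] fin aA by blast
  obtain b e where be: "b \<in> ?B" "e \<in> ?E" "y (b, e) \<noteq> 0" using y(1) by auto
  have "lookup (a e) (expo b) = (\<Sum>b'\<in>?B. if b' = b then y (b', e) else 0)"
    unfolding a_def lookup_sum by (intro sum.cong) (auto simp: lookup_single when_def)
  also have "\<dots> = y (b, e)" using be fin by simp
  finally show False using zero be by auto
qed

text \<open>
  The polynomials in the variables outside \<open>Z\<close> meet the prime only in \<open>0\<close>, so a chain of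
  length \<open>c\<close> below it produces \<open>c\<close> elements that are algebraically independent over them; then
  \<open>c \<le> card Z\<close>.
\<close>

lemma prime_height_var_ideal:
  "prime_height mpoly_ring (var_ideal Z :: ('n::finite, 'k::field) mpoly set) \<le> enat (card Z)"
  unfolding prime_height_def
proof (rule Sup_least)
  let ?P = "var_ideal Z :: ('n, 'k) mpoly set"
  fix h assume "h \<in> {enat (length Ps) |Ps. (\<forall>Q\<in>set Ps. primeideal Q mpoly_ring) \<and> sorted_wrt (\<subset>) (Ps @ [?P])}"
  then obtain Ps where Ps: "h = enat (length Ps)" "\<forall>Q\<in>set Ps. prime_set Q" "sorted_wrt (\<subset>) (Ps @ [?P])"
    by (auto simp: primeideal_ring_of_type_iff)
  let ?A = "polys_on {u. \<forall>i\<in>Z. u i = 0} :: ('n, 'k) mpoly set"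
  have "?A \<inter> ?P \<subseteq> {0}"
  proof
    fix f assume f: "f \<in> ?A \<inter> ?P"
    have "lookup f a = 0" for a
    proof (cases "\<forall>i\<in>Z. lookup a i = 0")
      case True
      then show ?thesis using f by (auto simp: var_ideal_def polys_on_iff)
    next
      case False
      then show ?thesis using f by (auto simp: polys_on_iff)
    qed
    then show "f \<in> {0}" by (simp add: poly_mapping_eqI)
  qed
  moreover have primes: "\<forall>Q\<in>set (Ps @ [?P]). prime_set Q" using Ps(2) prime_var_ideal by auto
  ultimately obtain fs where fs: "length fs = length Ps" "alg_indep_mod ?A (hd (Ps @ [?P])) fs"
    using prime_chain_alg_indep[OF Ps(3), of ?A] by blast
  have "hd (Ps @ [?P]) \<in> set (Ps @ [?P])" by (cases Ps) auto
  then have "ideal_set (hd (Ps @ [?P]))"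
    using primes prime_set_ideal by blast
  then have "\<not> card Z < length fs" using not_alg_indep fs(2) by blast
  then show "h \<le> enat (card Z)" using fs(1) Ps(1) by simp
qed

section \<open>Koszul homology\<close>

text \<open>
  The sign of moving \<open>e\<^sub>j\<close> to its place in the exterior product of the \<open>e\<^sub>l\<close>, \<open>l \<in> T\<close>. The
  variables are ordered by an arbitrary numbering.
\<close>

definition ksign :: "'n::finite \<Rightarrow> 'n set \<Rightarrow> 'a::comm_ring_1" where
  "ksign j T = (-1) ^ card {l \<in> T. to_nat l < to_nat j}"

text \<open>
  The differential of the Koszul complex on the sequence \<open>y\<close>. A chain \<open>c\<close> has coefficient \<open>c
  T\<close> at the exterior product of the \<open>e\<^sub>j\<close>, \<open>j \<in> T\<close>; chains of all degrees are treated at once,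
  and the degree \<open>card T\<close> enters only through the sets at which a condition is imposed.
\<close>

definition koszul :: "('n::finite \<Rightarrow> 'a::comm_ring_1) \<Rightarrow> ('n set \<Rightarrow> 'a) \<Rightarrow> 'n set \<Rightarrow> 'a" where
  "koszul y c T = (\<Sum>j\<in>-T. ksign j T * y j * c (insert j T))"

text \<open>Exterior multiplication by \<open>e\<^sub>j\<close>. It is a homotopy between multiplication by \<open>y j\<close> and zero.\<close>

definition koszul_homotopy :: "'n::finite \<Rightarrow> ('n set \<Rightarrow> 'a::comm_ring_1) \<Rightarrow> 'n set \<Rightarrow> 'a" where
  "koszul_homotopy j c T = (if j \<in> T then ksign j (T - {j}) * c (T - {j}) else 0)"

lemma ksign_square [simp]: "ksign j T * ksign j T = 1"
  by (simp add: ksign_def power_mult_distrib[symmetric])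

lemma ksign_insert:
  assumes "l \<notin> T"
  shows "ksign j (insert l T) = (if to_nat l < to_nat j then - ksign j T else ksign j T)"
proof -
  have "{i \<in> insert l T. to_nat i < to_nat j} =
      (if to_nat l < to_nat j then insert l {i \<in> T. to_nat i < to_nat j} else {i \<in> T. to_nat i < to_nat j})"
    by auto
  then show ?thesis using assms by (simp add: ksign_def)
qed

lemma ksign_swap:
  assumes "j \<noteq> l" "j \<notin> T" "l \<notin> T"
  shows "ksign l T * ksign j (insert l T) = - (ksign j T * ksign l (insert j T))"
proof -
  have "to_nat j \<noteq> to_nat l" using assms(1) by simp
  then consider "to_nat j < to_nat l" | "to_nat l < to_nat j" by linarith
  then show ?thesis using assms by cases (simp_all add: ksign_insert mult.commute)
qed

lemma ksign_insert_both:
  assumes "j \<noteq> l" "j \<notin> T" "l \<notin> T"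
  shows "ksign l (insert j T) * ksign j (insert l T) = - (ksign j T * ksign l T)"
proof -
  have "to_nat j \<noteq> to_nat l" using assms(1) by simp
  then consider "to_nat j < to_nat l" | "to_nat l < to_nat j" by linarith
  then show ?thesis using assms by cases (simp_all add: ksign_insert mult.commute)
qed

lemma sum_antisymmetric:
  fixes a :: "'n \<Rightarrow> 'n \<Rightarrow> 'a::comm_ring_1"
  assumes "finite S" "\<And>j l. j \<in> S \<Longrightarrow> l \<in> S \<Longrightarrow> j \<noteq> l \<Longrightarrow> a l j = - a j l"
  shows "(\<Sum>j\<in>S. \<Sum>l\<in>S - {j}. a j l) = 0"
  using assms
proof (induction S rule: finite_induct)
  case (insert p S)
  have "(\<Sum>l\<in>insert p S - {j}. a j l) = a j p + (\<Sum>l\<in>S - {j}. a j l)" if "j \<in> S" for j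
  proof -
    have "insert p S - {j} = insert p (S - {j})" "p \<notin> S - {j}" using that insert.hyps by auto
    then show ?thesis using insert.hyps by simp
  qed
  then have "(\<Sum>j\<in>S. \<Sum>l\<in>insert p S - {j}. a j l) = (\<Sum>j\<in>S. a j p) + (\<Sum>j\<in>S. \<Sum>l\<in>S - {j}. a j l)"
    by (simp add: sum.distrib)
  also have "(\<Sum>j\<in>S. a j p) = - (\<Sum>j\<in>S. a p j)"
    unfolding sum_negf[symmetric] using insert.hyps insert.prems by (intro sum.cong) auto
  also have "(\<Sum>j\<in>S. \<Sum>l\<in>S - {j}. a j l) = 0" using insert.IH insert.prems by blast
  finally show ?case using insert.hyps by simp
qed simp

text \<open>The terms in which \<open>j\<close> and \<open>l\<close> are added to \<open>T\<close> in either order cancel.\<close>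

lemma koszul_koszul: "koszul y (koszul y c) T = 0"
proof -
  let ?a = "\<lambda>j l. ksign j T * y j * (ksign l (insert j T) * y l * c (insert l (insert j T)))"
  have "koszul y (koszul y c) T = (\<Sum>j\<in>-T. \<Sum>l\<in>-T - {j}. ?a j l)"
    unfolding koszul_def sum_distrib_left by (intro sum.cong) auto
  also have "\<dots> = 0"
  proof (rule sum_antisymmetric)
    fix j l assume jl: "j \<in> -T" "l \<in> -T" "j \<noteq> l"
    have "?a l j = (ksign l T * ksign j (insert l T)) * (y j * y l * c (insert l (insert j T)))"
      by (simp add: ac_simps insert_commute)
    also have "\<dots> = - ?a j l"
      unfolding ksign_swap[OF jl(3) ComplD[OF jl(1)] ComplD[OF jl(2)]] by (simp add: ac_simps)
    finally show "?a l j = - ?a j l" .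
  qed simp
  finally show ?thesis .
qed

lemma koszul_add: "koszul y (\<lambda>T. c T + d T) T = koszul y c T + koszul y d T"
  by (simp add: koszul_def algebra_simps sum.distrib)

lemma koszul_diff: "koszul y (\<lambda>T. c T - d T) T = koszul y c T - koszul y d T"
  by (simp add: koszul_def algebra_simps sum_subtractf)

lemma koszul_scale: "koszul y (\<lambda>T. r * c T) T = r * koszul y c T"
  by (simp add: koszul_def sum_distrib_left ac_simps)

lemma koszul_in_ideal:
  assumes "ideal_set N" "\<And>j. j \<notin> T \<Longrightarrow> c (insert j T) \<in> N"
  shows "koszul y c T \<in> N"
  unfolding koszul_def using assms by (intro ideal_set_sum) (auto intro: ideal_set_closed)

lemma koszul_cong:
  assumes "\<And>j. j \<notin> T \<Longrightarrow> c (insert j T) = d (insert j T)"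
  shows "koszul y c T = koszul y d T"
  unfolding koszul_def using assms by (intro sum.cong) auto

lemma koszul_homotopy_formula:
  "koszul y (koszul_homotopy j c) T + koszul_homotopy j (koszul y c) T = y j * c T"
proof (cases "j \<in> T")
  case True
  then obtain U where U: "T = insert j U" "j \<notin> U" by (rule Set.set_insert)
  have mem: "-U = insert j (-T)" "j \<notin> -T" and TU: "T - {j} = U" using U by auto
  have "koszul_homotopy j (koszul y c) T = ksign j U * koszul y c U"
    using True TU by (simp add: koszul_homotopy_def)
  also have "\<dots> = (\<Sum>l\<in>-U. (ksign j U * ksign l U) * (y l * c (insert l U)))"
    unfolding koszul_def sum_distrib_left by (intro sum.cong refl) (simp only: mult.assoc)
  also have "\<dots> = y j * c T + (\<Sum>l\<in>-T. (ksign j U * ksign l U) * (y l * c (insert l U)))"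
    unfolding mem(1) using mem(2) U(1) by (subst sum.insert) simp_all
  also have "(\<Sum>l\<in>-T. (ksign j U * ksign l U) * (y l * c (insert l U))) =
      - (\<Sum>l\<in>-T. ksign l T * y l * koszul_homotopy j c (insert l T))"
    unfolding sum_negf[symmetric]
  proof (intro sum.cong refl)
    fix l assume l: "l \<in> -T"
    then have jl: "j \<noteq> l" "l \<notin> U" using U by auto
    have "insert l T - {j} = insert l U" "j \<in> insert l T" using jl U by auto
    then have "ksign l T * y l * koszul_homotopy j c (insert l T) =
        (ksign l (insert j U) * ksign j (insert l U)) * (y l * c (insert l U))"
      unfolding U(1) by (simp add: koszul_homotopy_def ac_simps)
    then show "(ksign j U * ksign l U) * (y l * c (insert l U)) =
        - (ksign l T * y l * koszul_homotopy j c (insert l T))"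
      unfolding ksign_insert_both[OF jl(1) U(2) jl(2)] by simp
  qed
  finally show ?thesis by (simp add: koszul_def[of y "koszul_homotopy j c"])
next
  case False
  have "koszul y (koszul_homotopy j c) T = (\<Sum>l\<in>-T. if l = j then y j * c T else 0)"
    unfolding koszul_def
  proof (intro sum.cong refl)
    fix l assume "l \<in> -T"
    show "ksign l T * y l * koszul_homotopy j c (insert l T) = (if l = j then y j * c T else 0)"
    proof (cases "l = j")
      case True
      have "insert j T - {j} = T" using False by auto
      then have "ksign l T * y l * koszul_homotopy j c (insert l T) =
          (ksign j T * ksign j T) * (y j * c T)"
        using True by (simp add: koszul_homotopy_def ac_simps)
      then show ?thesis using True by simp
    next
      case False
      then show ?thesis using \<open>j \<notin> T\<close> by (simp add: koszul_homotopy_def)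
    qed
  qed
  then show ?thesis using False by (simp add: koszul_homotopy_def)
qed

text \<open>
  The chain \<open>c\<close> agrees in degree \<open>i\<close>, modulo \<open>N\<close>, with a boundary of the complex with
  coefficients in \<open>M\<close>.
\<close>

definition koszul_boundary ::
  "('n::finite \<Rightarrow> 'a::comm_ring_1) \<Rightarrow> 'a set \<Rightarrow> 'a set \<Rightarrow> nat \<Rightarrow> ('n set \<Rightarrow> 'a) \<Rightarrow> bool" where
  "koszul_boundary y M N i c \<longleftrightarrow>
     (\<exists>d. (\<forall>T. d T \<in> M) \<and> (\<forall>T. card T = i \<longrightarrow> c T - koszul y d T \<in> N))"

text \<open>
  The \<open>i\<close>-th Koszul homology of \<open>M / N\<close> does not vanish. Ideals \<open>N \<subseteq> M\<close> represent the
  subquotient, so that neither quotients nor their elements have to be formed.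
\<close>

definition koszul_nonzero ::
  "('n::finite \<Rightarrow> 'a::comm_ring_1) \<Rightarrow> 'a set \<Rightarrow> 'a set \<Rightarrow> nat \<Rightarrow> bool" where
  "koszul_nonzero y M N i \<longleftrightarrow>
     (\<exists>c. (\<forall>T. c T \<in> M) \<and> (\<forall>T. Suc (card T) = i \<longrightarrow> koszul y c T \<in> N) \<and>
        \<not> koszul_boundary y M N i c)"

lemma koszul_annihilator_ideal:
  assumes M: "ideal_set M" and N: "ideal_set N"
  shows "ideal_set {g. koszul_boundary y M N i (\<lambda>T. g * c T)}"
  unfolding ideal_set_def
proof (intro conjI ballI allI)
  show "0 \<in> {g. koszul_boundary y M N i (\<lambda>T. g * c T)}"
    unfolding koszul_boundary_def using M N
    by (auto intro!: exI[of _ "\<lambda>_. 0"] simp: koszul_def ideal_set_closed)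
next
  fix g h assume "g \<in> {g. koszul_boundary y M N i (\<lambda>T. g * c T)}"
    "h \<in> {g. koszul_boundary y M N i (\<lambda>T. g * c T)}"
  then obtain d e where d: "\<forall>T. d T \<in> M" "\<forall>T. card T = i \<longrightarrow> g * c T - koszul y d T \<in> N"
    and e: "\<forall>T. e T \<in> M" "\<forall>T. card T = i \<longrightarrow> h * c T - koszul y e T \<in> N"
    by (auto simp: koszul_boundary_def)
  have "(g + h) * c T - koszul y (\<lambda>T. d T + e T) T \<in> N" if "card T = i" for T
  proof -
    have "(g + h) * c T - koszul y (\<lambda>T. d T + e T) T =
        (g * c T - koszul y d T) + (h * c T - koszul y e T)"
      by (simp add: koszul_add algebra_simps)
    also have "\<dots> \<in> N" using d(2) e(2) that by (intro ideal_set_closed(2)[OF N]) auto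
    finally show ?thesis .
  qed
  moreover have "\<forall>T. d T + e T \<in> M" using d(1) e(1) ideal_set_closed(2)[OF M] by blast
  ultimately show "g + h \<in> {g. koszul_boundary y M N i (\<lambda>T. g * c T)}"
    unfolding koszul_boundary_def by (intro CollectI exI[of _ "\<lambda>T. d T + e T"]) blast
next
  fix g r assume "g \<in> {g. koszul_boundary y M N i (\<lambda>T. g * c T)}"
  then obtain d where d: "\<forall>T. d T \<in> M" "\<forall>T. card T = i \<longrightarrow> g * c T - koszul y d T \<in> N"
    by (auto simp: koszul_boundary_def)
  have "r * g * c T - koszul y (\<lambda>T. r * d T) T \<in> N" if "card T = i" for T
  proof -
    have "r * g * c T - koszul y (\<lambda>T. r * d T) T = r * (g * c T - koszul y d T)"
      by (simp add: koszul_scale algebra_simps)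
    also have "\<dots> \<in> N" using d(2) that by (intro ideal_set_closed(3)[OF N]) auto
    finally show ?thesis .
  qed
  moreover have "\<forall>T. r * d T \<in> M" using d(1) ideal_set_closed(3)[OF M] by blast
  ultimately show "r * g \<in> {g. koszul_boundary y M N i (\<lambda>T. g * c T)}"
    unfolding koszul_boundary_def by (intro CollectI exI[of _ "\<lambda>T. r * d T"]) blast
qed

text \<open>
  Koszul homology is annihilated by the ideal of the sequence: the homotopy shows this for
  each \<open>y j\<close>, and the annihilator of a homology class is an ideal.
\<close>

lemma koszul_annihilator_contains:
  assumes M: "ideal_set M" and N: "ideal_set N"
    and c: "\<And>T. c T \<in> M" "\<And>T. Suc (card T) = i \<Longrightarrow> koszul y c T \<in> N"
    and g: "g \<in> genideal ring_of_type_algebra (range y)"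
  shows "koszul_boundary y M N i (\<lambda>T. g * c T)"
proof -
  let ?J = "{g. koszul_boundary y M N i (\<lambda>T. g * c T)}"
  have "koszul_boundary y M N i (\<lambda>T. y j * c T)" for j
  proof -
    have "y j * c T - koszul y (koszul_homotopy j c) T \<in> N" if "card T = i" for T
    proof -
      have "y j * c T - koszul y (koszul_homotopy j c) T = koszul_homotopy j (koszul y c) T"
        using koszul_homotopy_formula[of y j c T] by (simp add: algebra_simps)
      also have "\<dots> \<in> N"
      proof (cases "j \<in> T")
        case True
        then have "Suc (card (T - {j})) = i" using card_Suc_Diff1[of T j] that by simp
        then show ?thesis using c(2) True N by (simp add: koszul_homotopy_def ideal_set_closed)
      qed (use N in \<open>simp add: koszul_homotopy_def ideal_set_closed\<close>)
      finally show ?thesis .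
    qed
    moreover have "\<forall>T. koszul_homotopy j c T \<in> M"
      using c(1) M by (simp add: koszul_homotopy_def ideal_set_closed)
    ultimately show ?thesis unfolding koszul_boundary_def by blast
  qed
  then have "range y \<subseteq> ?J" by auto
  then have "genideal ring_of_type_algebra (range y) \<subseteq> ?J"
    unfolding genideal_ring_of_type using koszul_annihilator_ideal[OF M N]
    by (intro Inter_lower) simp
  then show ?thesis using g by blast
qed

text \<open>
  Some power of \<open>f\<close> annihilates the given class, so a suitable multiple \<open>c'\<close> of it is nonzero
  and is annihilated by \<open>f\<close>, say \<open>f c' = \<partial>d\<close> modulo \<open>N\<close>. Then \<open>d\<close> is a cycle modulo \<open>N + f M\<close>.
  If it were a boundary, \<open>f c'\<close> would be \<open>f\<close> times a boundary modulo \<open>N\<close>, and as \<open>f\<close> is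
  regular on \<open>M / N\<close>, \<open>c'\<close> would be a boundary itself. This is the connecting homomorphism of
  \<open>0 \<rightarrow> M/N \<rightarrow> M/N \<rightarrow> M/(N + f M) \<rightarrow> 0\<close>, read backwards.
\<close>

lemma koszul_nonzero_step:
  assumes M: "ideal_set M" and N: "ideal_set N" and N': "N' = {a + f * u | a u. a \<in> N \<and> u \<in> M}"
    and f: "f ^ k \<in> genideal ring_of_type_algebra (range y)"
    and reg: "\<And>u. u \<in> M \<Longrightarrow> f * u \<in> N \<Longrightarrow> u \<in> N"
    and nz: "koszul_nonzero y M N i"
  shows "koszul_nonzero y M N' (Suc i)"
proof -
  obtain c where c: "\<And>T. c T \<in> M" "\<And>T. Suc (card T) = i \<Longrightarrow> koszul y c T \<in> N"
    "\<not> koszul_boundary y M N i c" using nz by (auto simp: koszul_nonzero_def)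
  define s where "s = (LEAST s. koszul_boundary y M N i (\<lambda>T. f ^ s * c T))"
  have "koszul_boundary y M N i (\<lambda>T. f ^ k * c T)"
    using koszul_annihilator_contains[OF M N c(1,2) f] by simp
  then have s: "koszul_boundary y M N i (\<lambda>T. f ^ s * c T)" unfolding s_def by (rule LeastI)
  have "s \<noteq> 0"
  proof
    assume "s = 0"
    then show False using s c(3) by simp
  qed
  then obtain s' where s': "s = Suc s'" by (cases s) auto
  define c' where "c' T = f ^ s' * c T" for T
  have "\<not> koszul_boundary y M N i (\<lambda>T. f ^ s' * c T)"
    using not_less_Least[of s' "\<lambda>s. koszul_boundary y M N i (\<lambda>T. f ^ s * c T)"] s'
    unfolding s_def[symmetric] by simp
  then have c'_nb: "\<not> koszul_boundary y M N i c'" by (simp add: c'_def[abs_def])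
  have c'M: "c' T \<in> M" for T using c(1) M by (simp add: c'_def ideal_set_closed)
  obtain d where d: "\<forall>T. d T \<in> M" "\<forall>T. card T = i \<longrightarrow> f * c' T - koszul y d T \<in> N"
    using s unfolding koszul_boundary_def s' c'_def by (auto simp: mult.assoc)
  have "koszul y d T \<in> N'" if "card T = i" for T
  proof -
    have "koszul y d T = - (f * c' T - koszul y d T) + f * c' T" by simp
    moreover have "- (f * c' T - koszul y d T) \<in> N" using d(2) that N by (blast intro: ideal_set_closed)
    ultimately show ?thesis unfolding N' using c'M by blast
  qed
  moreover have "\<not> koszul_boundary y M N' (Suc i) d"
  proof
    assume "koszul_boundary y M N' (Suc i) d"
    then obtain e where e: "\<forall>T. e T \<in> M" "\<forall>T. card T = Suc i \<longrightarrow> d T - koszul y e T \<in> N'"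
      by (auto simp: koszul_boundary_def)
    have "\<exists>a u. a \<in> N \<and> u \<in> M \<and> (card T = Suc i \<longrightarrow> d T - koszul y e T = a + f * u)" for T
    proof (cases "card T = Suc i")
      case True
      then have "d T - koszul y e T \<in> N'" using e(2) by blast
      then show ?thesis unfolding N' by blast
    next
      case False
      then show ?thesis using ideal_set_closed(1)[OF M] ideal_set_closed(1)[OF N] by blast
    qed
    then obtain a u where au: "\<And>T. a T \<in> N" "\<And>T. u T \<in> M"
      "\<And>T. card T = Suc i \<Longrightarrow> d T - koszul y e T = a T + f * u T" by metis
    have "c' T - koszul y u T \<in> N" if T: "card T = i" for T
    proof (rule reg)
      show "c' T - koszul y u T \<in> M"
        using c'M au(2) M by (intro ideal_set_closed(6)[OF M] koszul_in_ideal) auto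
      have "koszul y (\<lambda>T. d T - koszul y e T) T = koszul y (\<lambda>T. a T + f * u T) T"
      proof (rule koszul_cong)
        fix j assume "j \<notin> T"
        then have "card (insert j T) = Suc i" using T by simp
        then show "d (insert j T) - koszul y e (insert j T) = a (insert j T) + f * u (insert j T)"
          by (rule au(3))
      qed
      then have "koszul y d T = koszul y a T + f * koszul y u T"
        by (simp add: koszul_diff koszul_add koszul_scale koszul_koszul)
      then have "f * (c' T - koszul y u T) = (f * c' T - koszul y d T) + koszul y a T"
        by (simp add: algebra_simps)
      also have "\<dots> \<in> N"
        using d(2) T au(1) by (intro ideal_set_closed(2)[OF N] koszul_in_ideal[OF N]) auto
      finally show "f * (c' T - koszul y u T) \<in> N" .
    qed
    then have "koszul_boundary y M N i c'" unfolding koszul_boundary_def using au(2) by blast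
    then show False using c'_nb by blast
  qed
  ultimately show ?thesis unfolding koszul_nonzero_def using d(1) by auto
qed

lemma koszul_nonzero_le:
  fixes y :: "'n::finite \<Rightarrow> 'a::comm_ring_1"
  assumes "ideal_set M" "koszul_nonzero y M N i"
  shows "i \<le> CARD('n)"
proof (rule ccontr)
  assume "\<not> i \<le> CARD('n)"
  moreover have "card T \<le> CARD('n)" for T :: "'n set" by (simp add: card_mono)
  ultimately have "card T \<noteq> i" for T :: "'n set" by metis
  then have "koszul_boundary y M N i c" for c
    unfolding koszul_boundary_def using ideal_set_closed(1)[OF assms(1)]
    by (intro exI[of _ "\<lambda>_. 0"]) blast
  then show False using assms(2) by (auto simp: koszul_nonzero_def)
qed

section \<open>Regular sequences and Koszul homology\<close>

text \<open>
  The ideal \<open>N + A M\<close>. As an intersection it can be compared directly with the submodules that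
  appear in the definition of a regular sequence.
\<close>

definition adjoin_multiples :: "'a::comm_ring_1 set \<Rightarrow> 'a set \<Rightarrow> 'a set \<Rightarrow> 'a set" where
  "adjoin_multiples M N A = \<Inter>{J. ideal_set J \<and> N \<subseteq> J \<and> (\<forall>a\<in>A. \<forall>u\<in>M. a * u \<in> J)}"

lemma ideal_set_adjoin_multiples: "ideal_set (adjoin_multiples M N A)"
  unfolding ideal_set_def adjoin_multiples_def by (auto intro: ideal_set_closed)

lemma adjoin_multiples_empty: "ideal_set N \<Longrightarrow> adjoin_multiples M N {} = N"
  unfolding adjoin_multiples_def by auto

lemma adjoin_multiples_insert:
  assumes "ideal_set M"
  shows "adjoin_multiples M N (insert f A) = {a + f * u | a u. a \<in> adjoin_multiples M N A \<and> u \<in> M}" (is "_ = ?R")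
proof (rule equalityI)
  note E = ideal_set_closed[OF ideal_set_adjoin_multiples[of M N A]] and M = ideal_set_closed[OF assms]
  have "ideal_set ?R"
    unfolding ideal_set_def
  proof (intro conjI ballI allI)
    show "0 \<in> ?R" using E(1) M(1) by force
  next
    fix x z assume "x \<in> ?R" "z \<in> ?R"
    then obtain a u b v where "x = a + f * u" "z = b + f * v"
      "a \<in> adjoin_multiples M N A" "u \<in> M" "b \<in> adjoin_multiples M N A" "v \<in> M" by blast
    moreover from this have "x + z = (a + b) + f * (u + v)" by (simp add: algebra_simps)
    ultimately show "x + z \<in> ?R" using E(2) M(2) by blast
  next
    fix x r assume "x \<in> ?R"
    then obtain a u where "x = a + f * u" "a \<in> adjoin_multiples M N A" "u \<in> M" by blast
    moreover from this have "r * x = r * a + f * (r * u)" by (simp add: algebra_simps)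
    ultimately show "r * x \<in> ?R" using E(3) M(3) by blast
  qed
  moreover have sub: "adjoin_multiples M N A \<subseteq> ?R"
  proof
    fix a assume "a \<in> adjoin_multiples M N A"
    moreover have "a = a + f * 0" by simp
    ultimately show "a \<in> ?R" using M(1) by blast
  qed
  moreover have "N \<subseteq> ?R" using sub unfolding adjoin_multiples_def by blast
  moreover have "\<forall>a\<in>insert f A. \<forall>u\<in>M. a * u \<in> ?R"
  proof (intro ballI)
    fix a u assume "a \<in> insert f A" "u \<in> M"
    then show "a * u \<in> ?R"
    proof (cases "a = f")
      case True
      have "f * u = 0 + f * u" by simp
      then show ?thesis using True \<open>u \<in> M\<close> E(1) by blast
    next
      case False
      then have "a * u \<in> adjoin_multiples M N A" using \<open>a \<in> insert f A\<close> \<open>u \<in> M\<close> unfolding adjoin_multiples_def by blast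
      then show ?thesis using sub by blast
    qed
  qed
  ultimately show "adjoin_multiples M N (insert f A) \<subseteq> ?R"
    unfolding adjoin_multiples_def[of M N "insert f A"] by (intro Inter_lower) blast
next
  show "?R \<subseteq> adjoin_multiples M N (insert f A)"
  proof
    fix x assume "x \<in> ?R"
    then obtain a u where x: "x = a + f * u" "a \<in> adjoin_multiples M N A" "u \<in> M" by blast
    show "x \<in> adjoin_multiples M N (insert f A)"
      unfolding adjoin_multiples_def
    proof (rule InterI)
      fix J assume J: "J \<in> {J. ideal_set J \<and> N \<subseteq> J \<and> (\<forall>a\<in>insert f A. \<forall>u\<in>M. a * u \<in> J)}"
      then have "a \<in> J" using x(2) unfolding adjoin_multiples_def by blast
      moreover have "f * u \<in> J" using J x(3) by blast
      ultimately show "x \<in> J" using J x(1) ideal_set_closed(2) by blast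
    qed
  qed
qed

text \<open>Regularity on \<open>M / N\<close>, apart from the condition that the last quotient does not vanish.\<close>

definition weakly_regular :: "'a::comm_ring_1 set \<Rightarrow> 'a set \<Rightarrow> 'a list \<Rightarrow> bool" where
  "weakly_regular M N fs \<longleftrightarrow>
     (\<forall>i<length fs. \<forall>u\<in>M. fs ! i * u \<in> adjoin_multiples M N (set (take i fs)) \<longrightarrow>
        u \<in> adjoin_multiples M N (set (take i fs)))"

text \<open>
  Each member of the sequence raises the degree of a nonvanishing homology group by one, and
  there is no homology above degree \<open>CARD('n)\<close>.
\<close>

lemma weakly_regular_length:
  fixes y :: "'n::finite \<Rightarrow> 'a::comm_ring_1"
  assumes M: "ideal_set M" and N: "ideal_set N"
    and reg: "weakly_regular M N fs"
    and nil: "\<forall>f\<in>set fs. \<exists>k. f ^ k \<in> genideal ring_of_type_algebra (range y)"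
    and nz: "koszul_nonzero y M N i"
  shows "i + length fs \<le> CARD('n)"
proof -
  have "koszul_nonzero y M (adjoin_multiples M N (set (take r fs))) (i + r)" if "r \<le> length fs" for r
    using that
  proof (induction r)
    case 0
    then show ?case using nz by (simp add: adjoin_multiples_empty[OF N])
  next
    case (Suc r)
    then have r: "r < length fs" by simp
    have "set (take (Suc r) fs) = insert (fs ! r) (set (take r fs))"
      using r by (simp add: take_Suc_conv_app_nth)
    then have E: "adjoin_multiples M N (set (take (Suc r) fs)) =
        {a + fs ! r * u | a u. a \<in> adjoin_multiples M N (set (take r fs)) \<and> u \<in> M}"
      using adjoin_multiples_insert[OF M] by simp
    obtain k where k: "(fs ! r) ^ k \<in> genideal ring_of_type_algebra (range y)"
      using nil r nth_mem by blast
    have "koszul_nonzero y M (adjoin_multiples M N (set (take (Suc r) fs))) (Suc (i + r))"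
    proof (rule koszul_nonzero_step[OF M ideal_set_adjoin_multiples E k])
      show "koszul_nonzero y M (adjoin_multiples M N (set (take r fs))) (i + r)" using Suc by simp
      show "u \<in> adjoin_multiples M N (set (take r fs))"
        if "u \<in> M" "fs ! r * u \<in> adjoin_multiples M N (set (take r fs))" for u
        using reg that r unfolding weakly_regular_def by blast
    qed
    then show ?case by simp
  qed
  from this[of "length fs"] show ?thesis using koszul_nonzero_le[OF M] by blast
qed

section \<open>Regular sequences on ideals and quotients\<close>

text \<open>Closure under negation follows from closure under multiplication by \<open>-1\<close>.\<close>

lemma submoduleI_smult:
  assumes M: "module R M" and sub: "H \<subseteq> carrier M" "\<zero>\<^bsub>M\<^esub> \<in> H"
    "\<And>a b. a \<in> H \<Longrightarrow> b \<in> H \<Longrightarrow> a \<oplus>\<^bsub>M\<^esub> b \<in> H"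
    "\<And>a x. a \<in> carrier R \<Longrightarrow> x \<in> H \<Longrightarrow> a \<odot>\<^bsub>M\<^esub> x \<in> H"
  shows "submodule H R M"
proof -
  interpret module R M by fact
  show ?thesis
  proof (rule submoduleI)
    fix a assume a: "a \<in> H"
    then have aM: "a \<in> carrier M" using sub(1) by blast
    have "(\<ominus>\<^bsub>R\<^esub> \<one>\<^bsub>R\<^esub>) \<odot>\<^bsub>M\<^esub> a = \<ominus>\<^bsub>M\<^esub> a"
      using smult_l_minus[OF one_closed aM] smult_one[OF aM] by simp
    then show "\<ominus>\<^bsub>M\<^esub> a \<in> H" using sub(4)[of "\<ominus>\<^bsub>R\<^esub> \<one>\<^bsub>R\<^esub>" a] a by simp
  qed (use sub in auto)
qed

lemma ideal_module_simps [simp]: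
  "carrier (ideal_module ring_of_type_algebra I) = I"
  "ring.zero (ideal_module ring_of_type_algebra I) = 0"
  "add (ideal_module ring_of_type_algebra I) = (+)"
  "module.smult (ideal_module ring_of_type_algebra I) = (*)"
  by (simp_all add: ideal_module_def)

lemma module_ideal_module:
  "ideal_set I \<Longrightarrow> module (ring_of_type_algebra :: 'a::comm_ring_1 ring) (ideal_module ring_of_type_algebra I)"
  by (rule ideal_module_is_module) (simp_all add: cring_from_type_algebra ideal_ring_of_type_iff)

lemma submodule_ideal_module_iff:
  assumes I: "ideal_set I"
  shows "submodule J (ring_of_type_algebra :: 'a::comm_ring_1 ring) (ideal_module ring_of_type_algebra I)
    \<longleftrightarrow> ideal_set J \<and> J \<subseteq> I"
proof
  assume J: "submodule J (ring_of_type_algebra :: 'a ring) (ideal_module ring_of_type_algebra I)"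
  then have "subgroup J (add_monoid (ideal_module ring_of_type_algebra I))"
    by (rule submodule.axioms)
  from subgroup.one_closed[OF this]
  have "0 \<in> J" by simp
  then show "ideal_set J \<and> J \<subseteq> I"
    using module.submoduleE[OF module_ideal_module[OF I] J]
    by (auto simp: ideal_set_def)
next
  assume "ideal_set J \<and> J \<subseteq> I"
  then show "submodule J (ring_of_type_algebra :: 'a ring) (ideal_module ring_of_type_algebra I)"
    by (intro submoduleI_smult[OF module_ideal_module[OF I]]) (auto intro: ideal_set_closed)
qed

lemma ideal_set_Int: "ideal_set I \<Longrightarrow> ideal_set J \<Longrightarrow> ideal_set (I \<inter> J)"
  by (auto simp: ideal_set_def)

lemma ideal_smult_ideal_module:
  assumes I: "ideal_set (I :: 'a::comm_ring_1 set)"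
  shows "ideal_smult ring_of_type_algebra (ideal_module ring_of_type_algebra I) A = adjoin_multiples I {0} A"
    (is "?L = ?R")
proof -
  have L: "?L = \<Inter>{J. ideal_set J \<and> J \<subseteq> I \<and> (\<forall>a\<in>A. \<forall>u\<in>I. a * u \<in> J)}"
    unfolding ideal_smult_def submodule_span_def submodule_ideal_module_iff[OF I]
    by (intro arg_cong[of _ _ Inter] Collect_cong) auto
  show ?thesis
  proof (rule equalityI)
    show "?L \<subseteq> ?R"
    proof
      fix x assume x: "x \<in> ?L"
      have "x \<in> J" if "ideal_set J" "\<forall>a\<in>A. \<forall>u\<in>I. a * u \<in> J" for J
      proof -
        have "x \<in> I \<inter> J"
          using x that ideal_set_Int[OF I that(1)] ideal_set_closed(3)[OF I] unfolding L by blast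
        then show ?thesis by simp
      qed
      then show "x \<in> ?R" unfolding adjoin_multiples_def by blast
    qed
    show "?R \<subseteq> ?L"
      unfolding L adjoin_multiples_def using ideal_set_closed(1) by blast
  qed
qed

abbreviation coset :: "'a::comm_ring_1 set \<Rightarrow> 'a \<Rightarrow> 'a set" where
  "coset I f \<equiv> I +>\<^bsub>ring_of_type_algebra\<^esub> f"

lemma coset_eq_iff:
  assumes I: "ideal_set I"
  shows "coset I f = coset I g \<longleftrightarrow> f - g \<in> I"
proof -
  have mem: "x \<in> coset I h \<longleftrightarrow> x - h \<in> I" for x h
    by (auto simp: a_r_coset_def') (metis diff_add_cancel)
  show ?thesis
  proof
    assume "coset I f = coset I g"
    moreover have "f \<in> coset I f" using ideal_set_closed(1)[OF I] by (simp add: mem)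
    ultimately show "f - g \<in> I" using mem by blast
  next
    assume fg: "f - g \<in> I"
    have "x - f \<in> I \<longleftrightarrow> x - g \<in> I" for x
    proof -
      have "x - g = (x - f) + (f - g)" "x - f = (x - g) - (f - g)" by simp_all
      then show ?thesis using fg ideal_set_closed(2,6)[OF I] by metis
    qed
    then show "coset I f = coset I g" using mem by blast
  qed
qed

lemma module_quot_module:
  "ideal_set I \<Longrightarrow> module (ring_of_type_algebra :: 'a::comm_ring_1 ring) (quot_module ring_of_type_algebra I)"
  by (rule quot_module_is_module) (simp_all add: cring_from_type_algebra ideal_ring_of_type_iff)

lemma quot_module_simps:
  assumes I: "ideal_set (I :: 'a::comm_ring_1 set)"
  shows "carrier (quot_module ring_of_type_algebra I) = range (coset I)"
    "ring.zero (quot_module ring_of_type_algebra I) = coset I 0"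
    "add (quot_module ring_of_type_algebra I) (coset I f) (coset I g) = coset I (f + g)"
    "module.smult (quot_module ring_of_type_algebra I) r (coset I f) = coset I (r * f)"
proof -
  let ?R = "ring_of_type_algebra :: 'a ring"
  interpret ideal I ?R using I by (simp add: ideal_ring_of_type_iff)
  interpret h: ring_hom_ring ?R "?R Quot I" "a_r_coset ?R I" by (rule rcos_ring_hom_ring)
  show "carrier (quot_module ?R I) = range (coset I)"
    by (auto simp: quot_module_def FactRing_def A_RCOSETS_def' a_r_coset_def)
  show "ring.zero (quot_module ?R I) = coset I 0"
    using h.hom_zero by (simp add: quot_module_def)
  show "add (quot_module ?R I) (coset I f) (coset I g) = coset I (f + g)"
    using h.hom_add[of f g] by (simp add: quot_module_def)
  show "module.smult (quot_module ?R I) r (coset I f) = coset I (r * f)"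
    using h.hom_mult[of r f] by (simp add: quot_module_def)
qed

text \<open>
  Submodules of the quotient by \<open>I\<close> correspond to ideals containing \<open>I\<close>, by taking images and
  preimages under the quotient map.
\<close>

lemma coset_in_ideal_smult_iff:
  assumes I: "ideal_set (I :: 'a::comm_ring_1 set)"
  shows "coset I x \<in> ideal_smult ring_of_type_algebra (quot_module ring_of_type_algebra I) A
    \<longleftrightarrow> x \<in> adjoin_multiples UNIV I A" (is "?lhs \<longleftrightarrow> ?rhs")
proof
  let ?R = "ring_of_type_algebra :: 'a ring" and ?M = "quot_module ring_of_type_algebra I"
  note M = quot_module_simps[OF I]
  {
    assume L: ?lhs
    let ?D = "coset I ` adjoin_multiples UNIV I A"
    note E = ideal_set_closed[OF ideal_set_adjoin_multiples[of UNIV I A]]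
    have "submodule ?D ?R ?M"
    proof (rule submoduleI_smult[OF module_quot_module[OF I]])
      show "?D \<subseteq> carrier ?M" unfolding M(1) by blast
      show "ring.zero ?M \<in> ?D" unfolding M(2) using E(1) by blast
      fix C D assume "C \<in> ?D" "D \<in> ?D"
      then show "C \<oplus>\<^bsub>?M\<^esub> D \<in> ?D" using E(2) by (auto simp: M(3))
    next
      fix r C assume "C \<in> ?D"
      then show "r \<odot>\<^bsub>?M\<^esub> C \<in> ?D" using E(3) by (auto simp: M(4))
    qed
    moreover have "{a \<odot>\<^bsub>?M\<^esub> u | a u. a \<in> A \<and> u \<in> carrier ?M} \<subseteq> ?D"
      by (auto simp: M(1,4) adjoin_multiples_def)
    ultimately have "coset I x \<in> ?D"
      using L unfolding ideal_smult_def submodule_span_def by blast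
    then obtain z where z: "z \<in> adjoin_multiples UNIV I A" "x - z \<in> I"
      using coset_eq_iff[OF I] by blast
    moreover have "I \<subseteq> adjoin_multiples UNIV I A" unfolding adjoin_multiples_def by blast
    ultimately have "(x - z) + z \<in> adjoin_multiples UNIV I A" using E(2) by blast
    then show ?rhs by simp
  }
  {
    assume R: ?rhs
    have "coset I x \<in> D"
      if D: "submodule D ?R ?M" "{a \<odot>\<^bsub>?M\<^esub> u | a u. a \<in> A \<and> u \<in> carrier ?M} \<subseteq> D" for D
    proof -
      note DE = module.submoduleE[OF module_quot_module[OF I] D(1)]
      have "subgroup D (add_monoid ?M)" using D(1) by (rule submodule.axioms)
      from subgroup.one_closed[OF this] have zero: "coset I 0 \<in> D" by (simp add: M(2))
      let ?J = "{x. coset I x \<in> D}"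
      have "ideal_set ?J"
        unfolding ideal_set_def
      proof (intro conjI ballI allI)
        show "0 \<in> ?J" using zero by simp
        fix x y assume "x \<in> ?J" "y \<in> ?J"
        then show "x + y \<in> ?J" using DE(5)[of "coset I x" "coset I y"] by (simp add: M(3))
      next
        fix x r assume "x \<in> ?J"
        then show "r * x \<in> ?J" using DE(4)[of r "coset I x"] by (simp add: M(4))
      qed
      moreover have "I \<subseteq> ?J"
      proof
        fix a assume "a \<in> I"
        then have "coset I a = coset I 0" using coset_eq_iff[OF I] by simp
        then show "a \<in> ?J" using zero by simp
      qed
      moreover have "\<forall>a\<in>A. \<forall>u\<in>UNIV. a * u \<in> ?J"
      proof (intro ballI)
        fix a u assume "a \<in> A"
        then have "a \<odot>\<^bsub>?M\<^esub> coset I u \<in> D" using D(2) unfolding M(1) by blast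
        then show "a * u \<in> ?J" by (simp add: M(4))
      qed
      ultimately have "adjoin_multiples UNIV I A \<subseteq> ?J"
        unfolding adjoin_multiples_def by (intro Inter_lower) blast
      then show ?thesis using R by blast
    qed
    then show ?lhs unfolding ideal_smult_def submodule_span_def by blast
  }
qed

lemma weakly_regular_ideal_module:
  assumes I: "ideal_set (I :: 'a::comm_ring_1 set)"
    and reg: "regular_sequence ring_of_type_algebra (ideal_module ring_of_type_algebra I) fs"
  shows "weakly_regular I {0} fs"
  using reg by (simp add: regular_sequence_def weakly_regular_def ideal_smult_ideal_module[OF I])

lemma weakly_regular_quot_module:
  assumes I: "ideal_set (I :: 'a::comm_ring_1 set)"
    and reg: "regular_sequence ring_of_type_algebra (quot_module ring_of_type_algebra I) fs"
  shows "weakly_regular UNIV I fs"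
  unfolding weakly_regular_def
proof (intro allI impI ballI)
  let ?M = "quot_module ring_of_type_algebra I"
  fix i u assume i: "i < length fs" and u: "fs ! i * u \<in> adjoin_multiples UNIV I (set (take i fs))"
  have "coset I u \<in> carrier ?M" by (simp add: quot_module_simps[OF I])
  moreover have "fs ! i \<odot>\<^bsub>?M\<^esub> coset I u \<in> ideal_smult ring_of_type_algebra ?M (set (take i fs))"
    using u by (simp add: quot_module_simps[OF I] coset_in_ideal_smult_iff[OF I])
  ultimately have "coset I u \<in> ideal_smult ring_of_type_algebra ?M (set (take i fs))"
    using reg i unfolding regular_sequence_def by blast
  then show "u \<in> adjoin_multiples UNIV I (set (take i fs))"
    by (simp add: coset_in_ideal_smult_iff[OF I])
qed

section \<open>Upper bounds for the depth\<close>

lemma max_ideal_eq: "(max_ideal :: ('n::finite, 'k::field) mpoly set) = polys_on {u. \<exists>i. 1 \<le> u i}"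
proof -
  have *: "range variable = (monomial ` range (\<lambda>i::'n. Poly_Mapping.single i 1) :: ('n, 'k) mpoly set)"
    by (auto simp: variable_def)
  have "lookup (Poly_Mapping.single i 1) \<le> u \<longleftrightarrow> 1 \<le> u i" for i and u :: "'n \<Rightarrow> nat"
    by (auto simp: le_fun_def lookup_single when_def)
  then show ?thesis
    unfolding max_ideal_def * genideal_monomials by simp
qed

abbreviation var_power :: "nat \<Rightarrow> 'n::finite \<Rightarrow> ('n, 'k::field) mpoly" where
  "var_power t i \<equiv> monomial (Poly_Mapping.single i t)"

lemma genideal_var_power:
  "genideal mpoly_ring (range (var_power t)) = (polys_on {u. \<exists>i. t \<le> u i} :: ('n::finite, 'k::field) mpoly set)"
proof -
  have "range (var_power t) = (monomial ` range (\<lambda>i::'n. Poly_Mapping.single i t) :: ('n, 'k) mpoly set)"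
    by auto
  moreover have "lookup (Poly_Mapping.single i t) \<le> u \<longleftrightarrow> t \<le> u i" for i and u :: "'n \<Rightarrow> nat"
    by (auto simp: le_fun_def lookup_single when_def)
  ultimately show ?thesis by (simp add: genideal_monomials)
qed

text \<open>A monomial of degree greater than \<open>n t\<close> is divisible by the \<open>t\<close>-th power of some variable.\<close>

lemma max_ideal_power:
  fixes f :: "('n::finite, 'k::field) mpoly"
  assumes "f \<in> max_ideal"
  shows "\<exists>k. f ^ k \<in> genideal mpoly_ring (range (var_power t))"
proof -
  have pow: "f ^ k \<in> polys_on {u. k \<le> sum u UNIV}" for k
  proof (induction k)
    case 0
    then show ?case by (simp add: polys_on_def)
  next
    case (Suc k)
    show ?case
      unfolding polys_on_def
    proof (intro CollectI ballI)
      fix c assume "c \<in> keys (f ^ Suc k)"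
      then obtain a b where ab: "a \<in> keys f" "b \<in> keys (f ^ k)" "c = a + b"
        using keys_mult[of f "f ^ k"] by auto
      obtain i where "1 \<le> lookup a i" using assms ab(1) by (auto simp: max_ideal_eq polys_on_def)
      also have "lookup a i \<le> sum (lookup a) UNIV" by (rule member_le_sum) auto
      finally have "1 \<le> sum (lookup a) UNIV" .
      moreover have "k \<le> sum (lookup b) UNIV" using Suc ab(2) by (auto simp: polys_on_def)
      ultimately show "Suc k \<le> sum (lookup c) UNIV" by (simp add: ab(3) lookup_add sum.distrib)
    qed
  qed
  have "\<exists>i. t \<le> u i" if "CARD('n) * t + 1 \<le> sum u UNIV" for u :: "'n \<Rightarrow> nat"
  proof (rule ccontr)
    assume "\<not> (\<exists>i. t \<le> u i)"
    then have "sum u UNIV \<le> (\<Sum>i\<in>(UNIV :: 'n set). t)"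
      by (intro sum_mono) (simp add: not_le less_imp_le)
    then show False using that by simp
  qed
  then have "polys_on {u. CARD('n) * t + 1 \<le> sum u UNIV} \<subseteq> (polys_on {u. \<exists>i. t \<le> u i} :: ('n, 'k) mpoly set)"
    by (intro polys_on_mono) auto
  then show ?thesis using pow unfolding genideal_var_power by blast
qed

lemma lookup_var_power_mult:
  fixes f :: "('n::finite, 'k::field) mpoly"
  shows "lookup (f * var_power t j * g) b =
    (if t \<le> lookup b j then lookup (f * g) (b - Poly_Mapping.single j t) else 0)"
proof -
  have "lookup (Poly_Mapping.single j t) \<le> lookup b \<longleftrightarrow> t \<le> lookup b j"
    by (auto simp: le_fun_def lookup_single when_def)
  moreover have "f * var_power t j * g = Poly_Mapping.single (Poly_Mapping.single j t) 1 * (f * g)"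
    by (simp add: monomial_def ac_simps)
  ultimately show ?thesis by (simp add: lookup_single_mult)
qed

lemma ksign_cases: "ksign j T = (1 :: 'a::comm_ring_1) \<or> ksign j T = (-1 :: 'a)"
  by (simp add: ksign_def minus_one_power_iff)

text \<open>
  From here on the monomial \<open>w\<close> lies outside the ideal, but its product with the \<open>t\<close>-th power of any
  variable in \<open>Z\<close> lies inside. The chain to consider is \<open>w\<close> times the exterior product of
  the \<open>e\<^sub>i\<close>, \<open>i \<in> Z\<close>, which is a cycle modulo \<open>I\<close> in degree \<open>card Z\<close>.
\<close>

context
  fixes U :: "('n::finite \<Rightarrow> nat) set" and I :: "('n, 'k::field) mpoly set"
    and w :: "'n \<Rightarrow> nat" and Z :: "'n set" and t :: nat
  assumes U: "upset U" and I: "I = polys_on U"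
    and w: "w \<notin> U" "\<And>i. i \<in> Z \<Longrightarrow> w(i := w i + t) \<in> U" "\<And>j. j \<notin> Z \<Longrightarrow> w j < t"
begin

private definition chain :: "'n set \<Rightarrow> ('n, 'k) mpoly" where
  "chain T = (if T = Z then monomial (expo w) else 0)"

private lemma ideal_I: "ideal_set I"
  using U by (simp add: I ideal_set_polys_on)

private lemma koszul_chain: "koszul (var_power t) chain T \<in> I"
  unfolding koszul_def
proof (rule ideal_set_sum[OF ideal_I])
  fix j assume j: "j \<in> -T"
  have "var_power t j * chain (insert j T) \<in> I"
  proof (cases "insert j T = Z")
    case True
    have "var_power t j * chain (insert j T) = monomial (Poly_Mapping.single j t + expo w)"
      using True by (simp add: chain_def monomial_def mult_single)
    moreover have "lookup (Poly_Mapping.single j t + expo w) = w(j := w j + t)"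
      by (auto simp: lookup_add lookup_single when_def)
    moreover have "j \<in> Z" using True by blast
    ultimately show ?thesis using w(2) by (simp add: I)
  qed (use ideal_set_closed(1)[OF ideal_I] in \<open>simp add: chain_def\<close>)
  then show "ksign j T * var_power t j * chain (insert j T) \<in> I"
    using ideal_set_closed(3)[OF ideal_I] by (simp add: mult.assoc)
qed

private lemma lookup_I: "f \<in> I \<Longrightarrow> lookup f (expo w) = 0"
  using w(1) by (simp add: I polys_on_iff)

text \<open>
  At the set \<open>Z\<close> a boundary has a coefficient in the ideal generated by the \<open>t\<close>-th powers of
  the variables outside \<open>Z\<close>. The monomial \<open>w\<close> lies neither in this ideal nor in \<open>I\<close>.
\<close>

lemma koszul_nonzero_quotient: "koszul_nonzero (var_power t) UNIV I (card Z)"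
proof -
  have "\<not> koszul_boundary (var_power t) UNIV I (card Z) chain"
  proof
    assume "koszul_boundary (var_power t) UNIV I (card Z) chain"
    then obtain d where "chain Z - koszul (var_power t) d Z \<in> I" by (auto simp: koszul_boundary_def)
    then have "lookup (chain Z - koszul (var_power t) d Z) (expo w) = 0" by (rule lookup_I)
    moreover have "lookup (koszul (var_power t) d Z) (expo w) = 0"
      unfolding koszul_def lookup_sum
    proof (intro sum.neutral ballI)
      fix j assume "j \<in> -Z"
      then have "\<not> t \<le> w j" using w(3)[of j] by simp
      then show "lookup (ksign j Z * var_power t j * d (insert j Z)) (expo w) = 0"
        by (simp add: lookup_var_power_mult)
    qed
    ultimately show False by (simp add: lookup_minus chain_def monomial_def)
  qed
  then show ?thesis unfolding koszul_nonzero_def using koszul_chain by blast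
qed

text \<open>
  The boundary of the chain above has coefficients in \<open>I\<close>. If it were also the boundary of a
  chain \<open>d\<close> with coefficients in \<open>I\<close>, then the difference \<open>e\<close> of the two chains would be a
  cycle over the polynomial ring. For \<open>i \<in> Z\<close>, its boundary at \<open>Z - {i}\<close> expresses \<open>x\<^sub>i\<^sup>t
  e(Z)\<close> by the \<open>t\<close>-th powers of the variables outside \<open>Z\<close>; but \<open>x\<^sub>i\<^sup>t w\<close> occurs in it with
  coefficient \<open>1\<close> and is divisible by none of them.
\<close>

lemma koszul_nonzero_ideal:
  assumes "Z \<noteq> {}"
  shows "koszul_nonzero (var_power t) I {0} (card Z - 1)"
proof -
  have "\<not> koszul_boundary (var_power t) I {0} (card Z - 1) (koszul (var_power t) chain)"
  proof
    assume "koszul_boundary (var_power t) I {0} (card Z - 1) (koszul (var_power t) chain)"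
    then obtain d where d: "\<forall>T. d T \<in> I"
      "\<And>T. card T = card Z - 1 \<Longrightarrow> koszul (var_power t) chain T = koszul (var_power t) d T"
      unfolding koszul_boundary_def by auto
    obtain i where i: "i \<in> Z" using assms by blast
    let ?T = "Z - {i}" and ?b = "expo w + Poly_Mapping.single i t"
    let ?e = "\<lambda>T. chain T - d T"
    have "koszul (var_power t) ?e ?T = 0" using d(2)[of ?T] i by (simp add: koszul_diff)
    then have "0 = lookup (koszul (var_power t) ?e ?T) ?b" by simp
    also have "\<dots> = (\<Sum>j\<in>-?T. lookup (ksign j ?T * var_power t j * ?e (insert j ?T)) ?b)"
      by (simp add: koszul_def lookup_sum)
    also have "\<dots> = (\<Sum>j\<in>-?T. if j = i then lookup (ksign i ?T * ?e Z) (expo w) else 0)"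
    proof (intro sum.cong refl)
      fix j assume j: "j \<in> -?T"
      show "lookup (ksign j ?T * var_power t j * ?e (insert j ?T)) ?b =
          (if j = i then lookup (ksign i ?T * ?e Z) (expo w) else 0)"
      proof (cases "j = i")
        case True
        have "insert i ?T = Z" using i by blast
        then show ?thesis using True by (simp add: lookup_var_power_mult lookup_add)
      next
        case False
        then have "lookup ?b j < t" using j w(3)[of j] by (simp add: lookup_add lookup_single when_def)
        then show ?thesis using False by (simp add: lookup_var_power_mult)
      qed
    qed
    also have "\<dots> = lookup (ksign i ?T * ?e Z) (expo w)" by simp
    finally have *: "lookup (ksign i ?T * ?e Z) (expo w) = 0" by simp
    have "ksign i ?T = (1 :: ('n, 'k) mpoly) \<or> ksign i ?T = (-1 :: ('n, 'k) mpoly)"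
      by (rule ksign_cases)
    then have "lookup (?e Z) (expo w) = 0"
    proof
      assume "ksign i ?T = (1 :: ('n, 'k) mpoly)"
      then show ?thesis using * by simp
    next
      assume "ksign i ?T = (-1 :: ('n, 'k) mpoly)"
      then show ?thesis using * by (simp add: lookup_minus)
    qed
    moreover have "lookup (d Z) (expo w) = 0" using d(1) lookup_I by blast
    ultimately show False by (simp add: lookup_minus chain_def monomial_def)
  qed
  then show ?thesis
    unfolding koszul_nonzero_def using koszul_chain
    by (intro exI[of _ "koszul (var_power t) chain"]) (simp add: koszul_koszul)
qed

lemma depth_quot_module_le:
  "depth mpoly_ring max_ideal (quot_module mpoly_ring I) \<le> enat (CARD('n) - card Z)"
  unfolding depth_def
proof (rule Sup_least)
  fix l assume "l \<in> {enat (length fs) |fs. set fs \<subseteq> max_ideal \<and>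
      regular_sequence mpoly_ring (quot_module mpoly_ring I) fs}"
  then obtain fs where fs: "l = enat (length fs)" "set fs \<subseteq> max_ideal"
    "regular_sequence mpoly_ring (quot_module mpoly_ring I) fs" by blast
  have "card Z + length fs \<le> CARD('n)"
    by (rule weakly_regular_length[OF _ ideal_I weakly_regular_quot_module[OF ideal_I fs(3)] _
          koszul_nonzero_quotient])
       (use fs(2) max_ideal_power in \<open>auto simp: ideal_set_def\<close>)
  then show "l \<le> enat (CARD('n) - card Z)" using fs(1) by simp
qed

lemma depth_ideal_module_le:
  assumes "Z \<noteq> {}"
  shows "depth mpoly_ring max_ideal (ideal_module mpoly_ring I) \<le> enat (CARD('n) + 1 - card Z)"
  unfolding depth_def
proof (rule Sup_least)
  fix l assume "l \<in> {enat (length fs) |fs. set fs \<subseteq> max_ideal \<and>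
      regular_sequence mpoly_ring (ideal_module mpoly_ring I) fs}"
  then obtain fs where fs: "l = enat (length fs)" "set fs \<subseteq> max_ideal"
    "regular_sequence mpoly_ring (ideal_module mpoly_ring I) fs" by blast
  have "card Z - 1 + length fs \<le> CARD('n)"
    by (rule weakly_regular_length[OF ideal_I _ weakly_regular_ideal_module[OF ideal_I fs(3)] _
          koszul_nonzero_ideal[OF assms]])
       (use fs(2) max_ideal_power in \<open>auto simp: ideal_set_def\<close>)
  then show "l \<le> enat (CARD('n) + 1 - card Z)" using fs(1) by simp
qed

end

section \<open>Stanley decompositions from boxes\<close>

lemma splits_list:
  assumes "splits d A"
  shows "\<exists>L. (\<forall>p\<in>set L. d \<le> card (snd p)) \<and>
    sorted_wrt (\<lambda>p q. box (fst p) (snd p) \<inter> box (fst q) (snd q) = {}) L \<and>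
    (\<Union>p\<in>set L. box (fst p) (snd p)) = A"
  using assms
proof induction
  case empty
  show ?case by (intro exI[of _ "[]"]) simp
next
  case (box Z v)
  then show ?case by (intro exI[of _ "[(v, Z)]"]) simp
next
  case (union A B)
  then obtain K L where
    K: "\<forall>p\<in>set K. d \<le> card (snd p)"
      "sorted_wrt (\<lambda>p q. box (fst p) (snd p) \<inter> box (fst q) (snd q) = {}) K"
      "(\<Union>p\<in>set K. box (fst p) (snd p)) = A"
    and L: "\<forall>p\<in>set L. d \<le> card (snd p)"
      "sorted_wrt (\<lambda>p q. box (fst p) (snd p) \<inter> box (fst q) (snd q) = {}) L"
      "(\<Union>p\<in>set L. box (fst p) (snd p)) = B"
    by blast
  have "\<forall>p\<in>set K. \<forall>q\<in>set L. box (fst p) (snd p) \<inter> box (fst q) (snd q) = {}"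
    using K(3) L(3) union.hyps(3) by blast
  then show ?case using K L
    by (intro exI[of _ "K @ L"]) (auto simp: sorted_wrt_append)
qed

text \<open>The Stanley space \<open>x\<^sup>v K[Z]\<close> consists of the polynomials supported on the box \<open>v + \<nat>\<^sup>Z\<close>.\<close>

lemma monomial_multiples_box:
  "(\<lambda>f. f * monomial (expo v)) ` polys_in Z = (polys_on (box v Z) :: ('n::finite, 'k::field) mpoly set)"
proof (rule equalityI)
  show "(\<lambda>f. f * monomial (expo v)) ` polys_in Z \<subseteq> (polys_on (box v Z) :: ('n, 'k) mpoly set)"
  proof
    fix g :: "('n, 'k) mpoly" assume "g \<in> (\<lambda>f. f * monomial (expo v)) ` polys_in Z"
    then obtain f where f: "f \<in> polys_in Z" "g = f * monomial (expo v)" by blast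
    show "g \<in> polys_on (box v Z)"
      unfolding polys_on_def
    proof (intro CollectI ballI)
      fix c assume "c \<in> keys g"
      then obtain a where a: "a \<in> keys f" "c = a + expo v"
        using keys_mult[of f "monomial (expo v)"] f(2) by (auto simp: monomial_def split: if_splits)
      have "keys a \<subseteq> Z" using f(1) a(1) by (auto simp: polys_in_def)
      then have "lookup a i = 0" if "i \<notin> Z" for i
        using that by (auto simp: in_keys_iff)
      then show "lookup c \<in> box v Z" by (simp add: box_def a(2) lookup_add le_fun_def)
    qed
  qed
next
  show "(polys_on (box v Z) :: ('n, 'k) mpoly set) \<subseteq> (\<lambda>f. f * monomial (expo v)) ` polys_in Z"
  proof
    fix g :: "('n, 'k) mpoly" assume g: "g \<in> polys_on (box v Z)"
    let ?f = "\<Sum>c\<in>keys g. Poly_Mapping.single (c - expo v) (lookup g c)"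
    have c: "(c - expo v) + expo v = c" if "c \<in> keys g" for c
      using exponent_add_diff[of "expo v" c] g that
      by (simp add: polys_on_def box_def add.commute)
    have "?f * monomial (expo v) = (\<Sum>c\<in>keys g. Poly_Mapping.single c (lookup g c))"
      using c by (simp add: sum_distrib_right monomial_def mult_single)
    then have "g = ?f * monomial (expo v)" using poly_mapping_sum_single[of g] by simp
    moreover have "?f \<in> polys_in Z"
      unfolding polys_in_def
    proof (intro CollectI ballI)
      fix a assume "a \<in> keys ?f"
      moreover have "keys ?f \<subseteq> (\<Union>c\<in>keys g. keys (Poly_Mapping.single (c - expo v) (lookup g c)))"
        by (rule keys_sum)
      ultimately have "a \<in> (\<Union>c\<in>keys g. keys (Poly_Mapping.single (c - expo v) (lookup g c)))"
        by (rule rev_subsetD)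
      then obtain b where b: "b \<in> keys g" "a = b - expo v" by (auto split: if_splits)
      then have "lookup b \<in> box v Z" using g by (auto simp: polys_on_def)
      then show "keys a \<subseteq> Z" by (auto simp: b(2) box_def in_keys_iff lookup_minus)
    qed
    ultimately show "g \<in> (\<lambda>f. f * monomial (expo v)) ` polys_in Z" by blast
  qed
qed

lemma monomial_mult_cancel:
  fixes f g :: "('n::finite, 'k::field) mpoly"
  assumes "f * monomial a = g * monomial a"
  shows "f = g"
proof (rule poly_mapping_eqI)
  fix b
  have "lookup (monomial a * h) (a + b) = lookup h b" for h :: "('n, 'k) mpoly"
    by (simp add: monomial_def)
  from this[of f] this[of g] show "lookup f b = lookup g b"
    using assms by (simp add: mult.commute)
qed

text \<open>
  Ideals and quotients are treated together: \<open>\<pi>\<close> identifies the polynomials supported on a set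
  \<open>A\<close> of exponents with the module, where \<open>A\<close> consists of the exponents inside or outside the
  ideal, and \<open>\<pi>\<close> is the identity or the quotient map. The boxes of a partition of \<open>A\<close> then
  give the summands, and the components of an element are the restrictions of its polynomial
  to the boxes.
\<close>

lemma sdepth_ge_of_splits:
  fixes M :: "(('n::finite, 'k::field) mpoly, 'm, 'c) module_scheme"
    and \<pi> :: "('n, 'k) mpoly \<Rightarrow> 'm"
  assumes M: "module mpoly_ring M"
    and bij: "bij_betw \<pi> (polys_on A) (carrier M)"
    and \<pi>_zero: "\<pi> 0 = \<zero>\<^bsub>M\<^esub>"
    and \<pi>_add: "\<And>f g. f \<in> polys_on A \<Longrightarrow> g \<in> polys_on A \<Longrightarrow> \<pi> (f + g) = \<pi> f \<oplus>\<^bsub>M\<^esub> \<pi> g"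
    and \<pi>_smult: "\<And>r f. f \<in> polys_on A \<Longrightarrow> r \<odot>\<^bsub>M\<^esub> \<pi> f = \<pi> (r * f)"
    and graded: "\<And>v. v \<in> A \<Longrightarrow> \<exists>e. \<pi> (monomial (expo v)) \<in> G e"
    and splits: "splits d A"
  shows "enat d \<le> sdepth M G"
proof -
  interpret module mpoly_ring M by fact
  obtain L where L: "\<forall>p\<in>set L. d \<le> card (snd p)"
    "sorted_wrt (\<lambda>p q. box (fst p) (snd p) \<inter> box (fst q) (snd q) = {}) L"
    "(\<Union>p\<in>set L. box (fst p) (snd p)) = A"
    using splits_list[OF splits] by blast
  define B where "B i = box (fst (L ! i)) (snd (L ! i))" for i
  define D where "D = map (\<lambda>p. (\<pi> (monomial (expo (fst p))), snd p)) L"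
  let ?J = "{..<length L}"
  have B_sub: "B i \<subseteq> A" if "i \<in> ?J" for i using L(3) that nth_mem[of i L] unfolding B_def by blast
  have B_cover: "\<exists>i\<in>?J. u \<in> B i" if "u \<in> A" for u
  proof -
    obtain p where p: "p \<in> set L" "u \<in> box (fst p) (snd p)" using \<open>u \<in> A\<close> L(3) by blast
    then obtain i where "i < length L" "L ! i = p" by (auto simp: in_set_conv_nth)
    then show ?thesis using p(2) by (intro bexI[of _ i]) (auto simp: B_def)
  qed
  have B_disj: "B i \<inter> B j = {}" if "i \<in> ?J" "j \<in> ?J" "i \<noteq> j" for i j
  proof (cases "i < j")
    case True
    then show ?thesis using sorted_wrt_nth_less[OF L(2), of i j] that unfolding B_def by simp
  next
    case False
    then show ?thesis using sorted_wrt_nth_less[OF L(2), of j i] that unfolding B_def by auto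
  qed
  have B_polys: "polys_on (B i) \<subseteq> polys_on A" if "i \<in> ?J" for i
    by (rule polys_on_mono[OF B_sub[OF that]])
  have \<pi>_carrier: "\<pi> f \<in> carrier M" if "f \<in> polys_on A" for f
    using bij_betwE[OF bij] that by blast
  have \<pi>_inj: "f = g" if "\<pi> f = \<pi> g" "f \<in> polys_on A" "g \<in> polys_on A" for f g
    using bij_betw_imp_inj_on[OF bij] that by (rule inj_onD)
  have vertex: "fst p \<in> A" "box (fst p) (snd p) \<subseteq> A" if "p \<in> set L" for p
  proof -
    show "box (fst p) (snd p) \<subseteq> A" using L(3) that by blast
    moreover have "fst p \<in> box (fst p) (snd p)" by (simp add: box_def)
    ultimately show "fst p \<in> A" by blast
  qed
  have space: "stanley_space M (D ! i) = \<pi> ` polys_on (B i)" if "i \<in> ?J" for i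
  proof -
    let ?p = "L ! i"
    have p: "?p \<in> set L" using that by simp
    have "stanley_space M (D ! i) = (\<lambda>f. f \<odot>\<^bsub>M\<^esub> \<pi> (monomial (expo (fst ?p)))) ` polys_in (snd ?p)"
      using that by (simp add: stanley_space_def D_def)
    also have "\<dots> = \<pi> ` (\<lambda>f. f * monomial (expo (fst ?p))) ` polys_in (snd ?p)"
      using vertex(1)[OF p] by (simp add: \<pi>_smult image_image)
    finally show ?thesis by (simp add: monomial_multiples_box B_def)
  qed
  have finsum: "(\<Oplus>\<^bsub>M\<^esub>j\<in>J. \<pi> (g j)) = \<pi> (sum g J)" if "finite J" "\<And>j. j \<in> J \<Longrightarrow> g j \<in> polys_on A" for g and J :: "nat set"
    using that
  proof (induction J rule: finite_induct)
    case empty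
    then show ?case by (simp add: \<pi>_zero)
  next
    case (insert j J)
    have "(\<Oplus>\<^bsub>M\<^esub>j\<in>insert j J. \<pi> (g j)) = \<pi> (g j) \<oplus>\<^bsub>M\<^esub> (\<Oplus>\<^bsub>M\<^esub>j\<in>J. \<pi> (g j))"
      using insert.hyps insert.prems by (intro finsum_insert) (auto intro: \<pi>_carrier)
    also have "\<dots> = \<pi> (g j + sum g J)"
      using insert by (simp add: \<pi>_add polys_on_sum)
    finally show ?case using insert.hyps by simp
  qed
  have part_sum: "(\<Sum>i\<in>?J. part (B i) f) = f" if f: "f \<in> polys_on A" for f
  proof (rule poly_mapping_eqI)
    fix a
    show "lookup (\<Sum>i\<in>?J. part (B i) f) a = lookup f a"
    proof (cases "lookup a \<in> A")
      case True
      then obtain i where i: "i \<in> ?J" "lookup a \<in> B i" using B_cover by blast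
      have "lookup (part (B j) f) a = (if j = i then lookup f a else 0)" if "j \<in> ?J" for j
        using B_disj[OF that i(1)] i(2) by (auto simp: lookup_part)
      then have "lookup (\<Sum>i\<in>?J. part (B i) f) a = (\<Sum>j\<in>?J. if j = i then lookup f a else 0)"
        by (simp add: lookup_sum)
      then show ?thesis using i(1) by simp
    next
      case False
      then have "lookup f a = 0" using f by (simp add: polys_on_iff)
      then show ?thesis by (simp add: lookup_sum lookup_part cong: if_cong)
    qed
  qed
  have sum_part: "part (B i) (\<Sum>j\<in>?J. g j) = g i" if g: "\<And>j. j \<in> ?J \<Longrightarrow> g j \<in> polys_on (B j)" and i: "i \<in> ?J" for g i
  proof (rule poly_mapping_eqI)
    fix a
    show "lookup (part (B i) (\<Sum>j\<in>?J. g j)) a = lookup (g i) a"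
    proof (cases "lookup a \<in> B i")
      case True
      have "lookup (g j) a = (if j = i then lookup (g i) a else 0)" if "j \<in> ?J" for j
        using B_disj[OF that i] g[OF that] True by (auto simp: polys_on_iff)
      then have "lookup (\<Sum>j\<in>?J. g j) a = (\<Sum>j\<in>?J. if j = i then lookup (g i) a else 0)"
        unfolding lookup_sum by (intro sum.cong) auto
      then show ?thesis using i True by (simp add: lookup_part)
    next
      case False
      then show ?thesis using g[OF i] by (simp add: lookup_part polys_on_iff)
    qed
  qed
  have direct: "internal_direct_sum M (\<lambda>i. \<pi> ` polys_on (B i)) ?J"
    unfolding internal_direct_sum_def
  proof (intro conjI ballI)
    fix i assume "i \<in> ?J"
    then show "\<pi> ` polys_on (B i) \<subseteq> carrier M" using B_polys \<pi>_carrier by blast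
  next
    fix u assume "u \<in> carrier M"
    then obtain f where f: "f \<in> polys_on A" "u = \<pi> f"
      using bij_betw_imp_surj_on[OF bij] by blast
    let ?v = "\<lambda>i\<in>?J. \<pi> (part (B i) f)"
    show "\<exists>!v. v \<in> (\<Pi>\<^sub>E j\<in>?J. \<pi> ` polys_on (B j)) \<and> u = (\<Oplus>\<^bsub>M\<^esub>j\<in>?J. v j)"
    proof (rule ex1I[of _ ?v], rule conjI)
      show "?v \<in> (\<Pi>\<^sub>E j\<in>?J. \<pi> ` polys_on (B j))" by auto
      have parts: "part (B i) f \<in> polys_on A" if "i \<in> ?J" for i
        using B_polys[OF that] part_in_polys_on by blast
      have "(\<Oplus>\<^bsub>M\<^esub>j\<in>?J. ?v j) = (\<Oplus>\<^bsub>M\<^esub>j\<in>?J. \<pi> (part (B j) f))"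
        using parts by (intro finsum_cong') (auto intro: \<pi>_carrier)
      also have "\<dots> = \<pi> (\<Sum>i\<in>?J. part (B i) f)" using parts by (intro finsum) auto
      finally show "u = (\<Oplus>\<^bsub>M\<^esub>j\<in>?J. ?v j)" using f(2) part_sum[OF f(1)] by simp
    next
      fix v assume v: "v \<in> (\<Pi>\<^sub>E j\<in>?J. \<pi> ` polys_on (B j)) \<and> u = (\<Oplus>\<^bsub>M\<^esub>j\<in>?J. v j)"
      then have "\<forall>j\<in>?J. \<exists>g. g \<in> polys_on (B j) \<and> v j = \<pi> g" by (auto simp: PiE_def Pi_def)
      then obtain g where g: "\<And>j. j \<in> ?J \<Longrightarrow> g j \<in> polys_on (B j)" "\<And>j. j \<in> ?J \<Longrightarrow> v j = \<pi> (g j)"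
        by metis
      have gA: "g j \<in> polys_on A" if "j \<in> ?J" for j using B_polys[OF that] g(1)[OF that] by blast
      have "u = (\<Oplus>\<^bsub>M\<^esub>j\<in>?J. v j)" using v by blast
      also have "\<dots> = (\<Oplus>\<^bsub>M\<^esub>j\<in>?J. \<pi> (g j))"
        using g(2) gA by (intro finsum_cong') (auto intro: \<pi>_carrier)
      also have "\<dots> = \<pi> (\<Sum>j\<in>?J. g j)" using gA by (intro finsum) auto
      finally have "\<pi> f = \<pi> (\<Sum>j\<in>?J. g j)" using f(2) by simp
      moreover have "(\<Sum>j\<in>?J. g j) \<in> polys_on A" by (rule polys_on_sum) (rule gA)
      ultimately have "f = (\<Sum>j\<in>?J. g j)" using f(1) by (intro \<pi>_inj)
      then have "part (B j) f = g j" if "j \<in> ?J" for j using sum_part[OF g(1) that] by (simp only:)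
      moreover have "v \<in> extensional ?J" using v by (auto simp: PiE_def)
      ultimately show "v = ?v" using g(2) by (intro extensionalityI[of _ ?J]) auto
    qed
  qed
  have cong: "internal_direct_sum M V J \<longleftrightarrow> internal_direct_sum M W J"
    if "\<And>j. j \<in> J \<Longrightarrow> V j = W j" for V W and J :: "nat set"
  proof -
    have "Pi\<^sub>E J V = Pi\<^sub>E J W" using that by (intro PiE_cong) auto
    then show ?thesis using that by (simp add: internal_direct_sum_def)
  qed
  have "internal_direct_sum M (\<lambda>i. stanley_space M (D ! i)) ?J"
    by (subst cong[OF space]) (assumption, rule direct)
  moreover have "length D = length L" by (simp add: D_def)
  ultimately have "internal_direct_sum M (\<lambda>i. stanley_space M (D ! i)) {..<length D}"
    by (simp only:)
  moreover have "m \<in> carrier M \<and> (\<exists>e. m \<in> G e) \<and> inj_on (\<lambda>f. f \<odot>\<^bsub>M\<^esub> m) (polys_in Z)"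
    if mZ: "(m, Z) \<in> set D" for m Z
  proof -
    obtain v where p: "(v, Z) \<in> set L" "m = \<pi> (monomial (expo v))" using mZ by (auto simp: D_def)
    have v: "v \<in> A" "box v Z \<subseteq> A" using vertex[OF p(1)] by simp_all
    have "inj_on (\<lambda>f. f \<odot>\<^bsub>M\<^esub> m) (polys_in Z)"
    proof (rule inj_onI)
      fix f g :: "('n, 'k) mpoly"
      assume fg: "f \<in> polys_in Z" "g \<in> polys_in Z" "f \<odot>\<^bsub>M\<^esub> m = g \<odot>\<^bsub>M\<^esub> m"
      have "h * monomial (expo v) \<in> polys_on A" if "h \<in> polys_in Z" for h :: "('n, 'k) mpoly"
        using that monomial_multiples_box[of v Z, where 'k = 'k] polys_on_mono[OF v(2)] by blast
      moreover have "\<pi> (f * monomial (expo v)) = \<pi> (g * monomial (expo v))"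
        using fg(3) v(1) by (simp add: p(2) \<pi>_smult)
      ultimately have "f * monomial (expo v) = g * monomial (expo v)"
        using fg(1,2) \<pi>_inj by blast
      then show "f = g" by (rule monomial_mult_cancel)
    qed
    then show ?thesis using graded[OF v(1)] \<pi>_carrier v(1) by (simp add: p(2))
  qed
  ultimately have "stanley_decomposition M G D"
    unfolding stanley_decomposition_def by blast
  then have "sdepth_decomposition D \<le> sdepth M G"
    unfolding sdepth_def by (intro Sup_upper) blast
  moreover have "enat d \<le> sdepth_decomposition D"
    unfolding sdepth_decomposition_def using L(1) by (intro Inf_greatest) (auto simp: D_def)
  ultimately show ?thesis by (rule order_trans[rotated])
qed

lemma monomial_in_poly_grading: "monomial (expo v) \<in> poly_grading (\<lambda>i. int (v i))"
  by (simp add: poly_grading_def monomial_def)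

lemma sdepth_ideal_module_ge:
  assumes U: "upset U" and "splits d U"
  shows "enat d \<le> sdepth (ideal_module mpoly_ring (polys_on U :: ('n::finite, 'k::field) mpoly set))
    (ideal_grading (polys_on U))"
proof (rule sdepth_ge_of_splits[where \<pi> = "\<lambda>f. f" and A = U])
  show "module mpoly_ring (ideal_module mpoly_ring (polys_on U :: ('n, 'k) mpoly set))"
    by (rule module_ideal_module[OF ideal_set_polys_on[OF U]])
  show "\<exists>e. monomial (expo v) \<in> ideal_grading (polys_on U :: ('n, 'k) mpoly set) e" if "v \<in> U" for v
    using that monomial_in_poly_grading by (auto simp: ideal_grading_def)
qed (use assms(2) in \<open>auto simp: bij_betw_def\<close>)

lemma sdepth_quot_module_ge:
  assumes U: "upset U" and "splits d (- U)"
  shows "enat d \<le> sdepth (quot_module mpoly_ring (polys_on U :: ('n::finite, 'k::field) mpoly set))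
    (quot_grading (polys_on U))"
proof (rule sdepth_ge_of_splits[where \<pi> = "coset (polys_on U)" and A = "- U"])
  let ?I = "polys_on U :: ('n, 'k) mpoly set"
  have I: "ideal_set ?I" by (rule ideal_set_polys_on[OF U])
  note Q = quot_module_simps[OF I]
  show "module mpoly_ring (quot_module mpoly_ring ?I)" by (rule module_quot_module[OF I])
  show "\<exists>e. coset ?I (monomial (expo v)) \<in> quot_grading ?I e" for v
    using monomial_in_poly_grading unfolding quot_grading_def by blast
  show "bij_betw (coset ?I) (polys_on (- U)) (carrier (quot_module mpoly_ring ?I))"
  proof (rule bij_betw_imageI)
    show "inj_on (coset ?I) (polys_on (- U))"
    proof (rule inj_onI)
      fix f g :: "('n, 'k) mpoly"
      assume "f \<in> polys_on (- U)" "g \<in> polys_on (- U)" "coset ?I f = coset ?I g"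
      then have "f - g \<in> polys_on (- U)" "f - g \<in> ?I" by (auto simp: coset_eq_iff[OF I])
      then have "lookup (f - g) a = 0" for a by (cases "lookup a \<in> U") (auto simp: polys_on_iff)
      then have "f - g = 0" by (intro poly_mapping_eqI) simp
      then show "f = g" by simp
    qed
    show "coset ?I ` polys_on (- U) = carrier (quot_module mpoly_ring ?I)"
      unfolding Q(1)
    proof (intro equalityI subsetI)
      fix C assume "C \<in> range (coset ?I)"
      then obtain f where f: "C = coset ?I f" by blast
      have "f - part (- U) f \<in> ?I" by (auto simp: polys_on_iff lookup_minus lookup_part)
      then have "C = coset ?I (part (- U) f)" using f coset_eq_iff[OF I] by simp
      then show "C \<in> coset ?I ` polys_on (- U)" by (rule image_eqI) simp
    qed auto
  qed
qed (use assms(2) in \<open>simp_all add: quot_module_simps[OF ideal_set_polys_on[OF U]]\<close>)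

section \<open>Monomial almost complete intersections\<close>

text \<open>
  The hypothesis \<open>cover\<close> is what remains of the assumption on the number of generators: a set
  of variables that meets the support of all generators generates a prime containing the
  ideal, and the height of this prime is at most the number of the variables.
\<close>

lemma depth_le_sdepth:
  fixes U :: "('n::finite \<Rightarrow> nat) set" and I :: "('n, 'k::field) mpoly set"
  assumes U: "upset U" and I: "I = polys_on U"
    and G: "G = minimal_elements U" "finite G" "G \<noteq> {}" "(\<lambda>_. 0) \<notin> U"
    and cover: "\<And>Z. \<forall>g\<in>G. \<exists>i\<in>Z. 0 < g i \<Longrightarrow> card G \<le> card Z + 1"
  shows "depth mpoly_ring max_ideal (quot_module mpoly_ring I)
           \<le> sdepth (quot_module mpoly_ring I) (quot_grading I)"
    and "depth mpoly_ring max_ideal (ideal_module mpoly_ring I)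
           \<le> sdepth (ideal_module mpoly_ring I) (ideal_grading I)"
proof -
  have U_eq: "U = {u. \<exists>g\<in>G. g \<le> u}" using upset_minimal_elements[OF U] G(1) by simp
  then have U_compl: "- U = {u. \<forall>g\<in>G. \<not> g \<le> u}" by blast
  have pos: "\<exists>i. 0 < g i" if "g \<in> G" for g
  proof (rule ccontr)
    assume "\<not> (\<exists>i. 0 < g i)"
    then have "g = (\<lambda>_. 0)" by auto
    then show False using that G(1,4) by (auto simp: minimal_elements_def)
  qed
  have antichain: "g = h" if "g \<in> G" "h \<in> G" "g \<le> h" for g h
    using that unfolding G(1) by (auto simp: minimal_elements_def)
  obtain s where s: "\<And>g i. g \<in> G \<Longrightarrow> g i \<le> s"
  proof
    fix g i assume g: "g \<in> G"
    have "g i \<le> sum g UNIV" by (rule member_le_sum) auto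
    also have "\<dots> \<le> (\<Sum>g\<in>G. sum g UNIV)" using G(2) g by (intro member_le_sum) auto
    finally show "g i \<le> (\<Sum>g\<in>G. sum g UNIV)" .
  qed
  \<comment> \<open>It suffices to separate depth and Stanley depth by numbers, \<open>a\<close> for the quotient and \<open>b\<close> for the ideal.\<close>
  have "\<exists>a b. depth mpoly_ring max_ideal (quot_module mpoly_ring I) \<le> enat a \<and> splits a (- U) \<and>
      depth mpoly_ring max_ideal (ideal_module mpoly_ring I) \<le> enat b \<and> splits b U"
  proof (cases "\<forall>g\<in>G. \<exists>i. 0 < g i \<and> (\<forall>h\<in>G - {g}. h i < g i)")
    case True
    then obtain j where j: "\<And>g. g \<in> G \<Longrightarrow> 0 < g (j g)"
      "\<And>g h. g \<in> G \<Longrightarrow> h \<in> G \<Longrightarrow> h \<noteq> g \<Longrightarrow> h (j g) < g (j g)"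
      by (metis Diff_iff singletonD)
    define m where "m i = Max ((\<lambda>g. g i) ` G)" for i
    have m_ge: "g i \<le> m i" if "g \<in> G" for g i unfolding m_def using G(2) that by (intro Max_ge) auto
    have m_j: "m (j g) = g (j g)" if "g \<in> G" for g
      unfolding m_def using G(2) that j(2)[OF that] by (intro Max_eqI) (auto simp: le_less)
    have m_le: "m i \<le> s" for i unfolding m_def using G(2,3) s by (intro Max.boundedI) auto
    \<comment> \<open>\<open>m\<close> is the least common multiple of the generators; one variable is taken off for each generator.\<close>
    let ?Z = "j ` G"
    let ?w = "\<lambda>i. if i \<in> ?Z then m i - 1 else m i"
    have "inj_on j G"
    proof (rule inj_onI)
      fix g h assume "g \<in> G" "h \<in> G" "j g = j h"
      then show "g = h" using j(2)[of g h] j(2)[of h g] by force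
    qed
    then have cZ: "card ?Z = card G" by (rule card_image)
    have w1: "?w \<notin> U"
    proof
      assume "?w \<in> U"
      then obtain g where g: "g \<in> G" "g \<le> ?w" unfolding U_eq by blast
      have "g (j g) \<le> ?w (j g)" using g(2) by (rule le_funD)
      then show False using g(1) j(1)[OF g(1)] m_j[OF g(1)] by simp
    qed
    have w2: "?w(i := ?w i + Suc s) \<in> U" if "i \<in> ?Z" for i
    proof -
      obtain g where g: "g \<in> G" "i = j g" using \<open>i \<in> ?Z\<close> by blast
      have "g l \<le> (?w(i := ?w i + Suc s)) l" for l
      proof (cases "l = i")
        case True
        then show ?thesis using s[OF g(1), of i] by simp
      next
        case l: False
        show ?thesis
        proof (cases "l \<in> ?Z")
          case True
          then obtain h where h: "h \<in> G" "l = j h" by blast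
          then have "g l < h l" using j(2)[OF h(1) g(1)] g(2) l by blast
          moreover have "m l = h l" using m_j h by simp
          ultimately have "g l \<le> m l - 1" by simp
          then show ?thesis using l True by simp
        next
          case False
          then show ?thesis using l m_ge[OF g(1)] by simp
        qed
      qed
      then have "g \<le> ?w(i := ?w i + Suc s)" by (rule le_funI)
      then show ?thesis unfolding U_eq using g(1) by blast
    qed
    have w3: "?w i < Suc s" if "i \<notin> ?Z" for i using that m_le[of i] by simp
    have "depth mpoly_ring max_ideal (quot_module mpoly_ring I) \<le> enat (CARD('n) - card ?Z)"
      by (rule depth_quot_module_le[OF U I w1 w2 w3])
    moreover have "depth mpoly_ring max_ideal (ideal_module mpoly_ring I) \<le> enat (CARD('n) + 1 - card ?Z)"
    proof (rule depth_ideal_module_le[OF U I w1 w2 w3])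
      show "?Z \<noteq> {}" using G(3) by blast
    qed
    moreover have "splits (CARD('n) - card G) (- U)"
      unfolding U_compl by (rule splits_complement[OF G(2)])
    moreover have "splits (CARD('n) + 1 - card G) U"
    proof -
      have "0 < card G" using G(2,3) by (simp add: card_gt_0_iff)
      then have "CARD('n) + 1 - card G = CARD('n) - (card G - 1)" by simp
      moreover have "splits (CARD('n) - (card G - 1)) U"
        by (subst U_eq) (rule splits_ideal[OF G(2)])
      ultimately show ?thesis by (simp only:)
    qed
    ultimately show ?thesis unfolding cZ by blast
  next
    case False
    then obtain g0 where g0': "g0 \<in> G" "\<not> (\<exists>i. 0 < g0 i \<and> (\<forall>h\<in>G - {g0}. h i < g0 i))"
      by blast
    have g0: "g0 \<in> G" "\<And>i. 0 < g0 i \<Longrightarrow> \<exists>g\<in>G - {g0}. g0 i \<le> g i"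
      using g0' by (simp_all only: not_less[symmetric]) blast
    \<comment> \<open>A single generator is never redundant, and of two generators a redundant one would divide the other.\<close>
    have card3: "3 \<le> card G"
    proof (rule ccontr)
      assume "\<not> 3 \<le> card G"
      then have le1: "card (G - {g0}) \<le> 1" using g0(1) G(2) by simp
      obtain i where "0 < g0 i" using pos[OF g0(1)] by blast
      then obtain g where g: "g \<in> G - {g0}" using g0(2) by blast
      have "G - {g0} = {g}"
        using le1 g G(2) by (intro card_subset_eq[symmetric]) (auto simp: le_Suc_eq)
      then have "g0 i \<le> g i" for i using g0(2)[of i] by (cases "0 < g0 i") auto
      then show False using antichain[OF g0(1), of g] g by (auto simp: le_fun_def)
    qed
    let ?cover = "\<lambda>Z. \<forall>g\<in>G. \<exists>i\<in>Z. 0 < g i"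
    have "?cover UNIV" using pos by simp
    then obtain Z where Z: "?cover Z" "\<And>Z'. ?cover Z' \<Longrightarrow> card Z \<le> card Z'"
      using ex_has_least_nat[of ?cover UNIV card] by blast
    have "Z \<noteq> {}" using Z(1) G(3) by blast
    \<comment> \<open>By minimality of \<open>Z\<close>, each \<open>i \<in> Z\<close> has a generator that involves no other variable of \<open>Z\<close>.\<close>
    let ?w = "\<lambda>i. if i \<in> Z then 0 else s"
    have w1: "?w \<notin> U"
    proof
      assume "?w \<in> U"
      then obtain g where g: "g \<in> G" "g \<le> ?w" unfolding U_eq by blast
      then obtain i where i: "i \<in> Z" "0 < g i" using Z(1) by blast
      then show False using le_funD[OF g(2), of i] by simp
    qed
    have w2: "?w(i := ?w i + Suc s) \<in> U" if i: "i \<in> Z" for i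
    proof -
      have less: "card (Z - {i}) < card Z" by (rule card_Diff1_less[OF _ i]) simp
      have "\<not> ?cover (Z - {i})"
      proof
        assume "?cover (Z - {i})"
        then have "card Z \<le> card (Z - {i})" by (rule Z(2))
        with less show False by simp
      qed
      then obtain g where g': "g \<in> G" "\<not> (\<exists>l\<in>Z - {i}. 0 < g l)" by blast
      then have g: "g \<in> G" "\<And>l. l \<in> Z - {i} \<Longrightarrow> g l = 0" by auto
      have "g l \<le> (?w(i := ?w i + Suc s)) l" for l
      proof (cases "l = i")
        case True
        then show ?thesis using s[OF g(1), of i] by simp
      next
        case False
        then show ?thesis using g(2)[of l] s[OF g(1), of l] by simp
      qed
      then have "g \<le> ?w(i := ?w i + Suc s)" by (rule le_funI)
      then show ?thesis unfolding U_eq using g(1) by blast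
    qed
    have w3: "?w i < Suc s" if "i \<notin> Z" for i by simp
    have cG: "card G \<le> card Z + 1" by (rule cover[OF Z(1)])
    have "depth mpoly_ring max_ideal (quot_module mpoly_ring I) \<le> enat (CARD('n) - card Z)"
      by (rule depth_quot_module_le[OF U I w1 w2 w3])
    also have "\<dots> \<le> enat (CARD('n) - 1 - (card G - 2))" using cG card3 by simp
    finally have "depth mpoly_ring max_ideal (quot_module mpoly_ring I) \<le> enat (CARD('n) - 1 - (card G - 2))" .
    moreover have "splits (CARD('n) - 1 - (card G - 2)) (- U)"
      unfolding U_compl by (rule splits_complement_redundant[OF G(2) g0])
    moreover have "depth mpoly_ring max_ideal (ideal_module mpoly_ring I) \<le> enat (CARD('n) + 1 - card Z)"
      by (rule depth_ideal_module_le[OF U I w1 w2 w3 \<open>Z \<noteq> {}\<close>])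
    then have "depth mpoly_ring max_ideal (ideal_module mpoly_ring I) \<le> enat (CARD('n) - (card G - 2))"
      by (rule order_trans) (use cG card3 in simp)
    moreover have "splits (CARD('n) - (card G - 2)) U"
      by (subst U_eq) (rule splits_ideal_three[OF G(2) card3])
    ultimately show ?thesis by blast
  qed
  then obtain a b where
    a: "depth mpoly_ring max_ideal (quot_module mpoly_ring I) \<le> enat a" "splits a (- U)"
    and b: "depth mpoly_ring max_ideal (ideal_module mpoly_ring I) \<le> enat b" "splits b U"
    by blast
  show "depth mpoly_ring max_ideal (quot_module mpoly_ring I)
      \<le> sdepth (quot_module mpoly_ring I) (quot_grading I)"
    using a(1) sdepth_quot_module_ge[OF U a(2)] unfolding I by (rule order_trans)
  show "depth mpoly_ring max_ideal (ideal_module mpoly_ring I)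
      \<le> sdepth (ideal_module mpoly_ring I) (ideal_grading I)"
    using b(1) sdepth_ideal_module_ge[OF U b(2)] unfolding I by (rule order_trans)
qed

theorem corollary1p9:
  fixes I :: "('n::finite, 'k::field) mpoly set"
  assumes "monomial_ideal I" and "almost_complete_intersection I"
  shows "depth mpoly_ring max_ideal (quot_module mpoly_ring I)
           \<le> sdepth (quot_module mpoly_ring I) (quot_grading I) \<and>
         depth mpoly_ring max_ideal (ideal_module mpoly_ring I)
           \<le> sdepth (ideal_module mpoly_ring I) (ideal_grading I)"
proof -
  obtain A where A: "I = genideal mpoly_ring (monomial ` A)" using assms(1) by (auto simp: monomial_ideal_def)
  define U where "U = {u. \<exists>a\<in>A. lookup a \<le> u}"
  have I: "I = polys_on U" unfolding A U_def by (rule genideal_monomials)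
  have U: "upset U" unfolding U_def upset_def using order_trans by blast
  let ?G = "minimal_elements U"
  have aci: "I \<noteq> UNIV" "I \<noteq> {0}" "min_gens mpoly_ring I = height mpoly_ring I + 1"
    using assms(2) by (auto simp: almost_complete_intersection_def)
  have zero: "(\<lambda>_. 0) \<notin> U"
  proof
    assume "(\<lambda>_. 0) \<in> U"
    then have "U = UNIV" using upsetD[OF U] by (auto simp: le_fun_def)
    then show False using aci(1) by (simp add: I polys_on_def)
  qed
  have ne: "?G \<noteq> {}"
  proof
    assume "?G = {}"
    then have "U = {}" using minimal_element_below[of _ U] by blast
    then have "I \<subseteq> {0}" by (auto simp: I polys_on_iff intro: poly_mapping_eqI)
    then show False using aci(2) ideal_set_closed(1)[OF ideal_set_polys_on[OF U]] I by blast
  qed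
  have height_le: "height mpoly_ring I \<le> enat (card Z)" if Z: "\<forall>g\<in>?G. \<exists>i\<in>Z. 0 < g i" for Z
  proof -
    have "U \<subseteq> {u. \<exists>i\<in>Z. 0 < u i}"
    proof
      fix u assume "u \<in> U"
      then obtain g where g: "g \<in> ?G" "g \<le> u" using minimal_element_below by blast
      then obtain i where i: "i \<in> Z" "0 < g i" using Z by blast
      have "g i \<le> u i" using g(2) by (rule le_funD)
      then have "0 < u i" using i(2) by simp
      then show "u \<in> {u. \<exists>i\<in>Z. 0 < u i}" using i(1) by blast
    qed
    then have "I \<subseteq> var_ideal Z" unfolding I var_ideal_def by (rule polys_on_mono)
    then have "height mpoly_ring I \<le> prime_height mpoly_ring (var_ideal Z :: ('n, 'k) mpoly set)"
      unfolding height_def using prime_var_ideal[of Z, where 'k = 'k]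
      by (intro Inf_lower) (auto simp: primeideal_ring_of_type_iff)
    also have "\<dots> \<le> enat (card Z)" by (rule prime_height_var_ideal)
    finally show ?thesis .
  qed
  have "\<forall>g\<in>?G. \<exists>i\<in>UNIV. 0 < g i"
  proof
    fix g assume "g \<in> ?G"
    then have "g \<noteq> (\<lambda>_. 0)" using zero by (auto simp: minimal_elements_def)
    then show "\<exists>i\<in>UNIV. 0 < g i" by auto
  qed
  from enat_ile[OF height_le[OF this]] obtain h where h: "height mpoly_ring I = enat h"
    by blast
  have "min_gens mpoly_ring I < enat (h + 2)" using aci(3) h by (simp add: one_enat_def)
  then obtain B where B: "finite B" "genideal mpoly_ring B = I" "card B < h + 2"
    unfolding min_gens_def Inf_less_iff by auto
  have fin: "finite ?G" and le: "card ?G \<le> card B"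
    using card_minimal_elements_le[OF B(1)] B(2) I by auto
  have "card ?G \<le> card Z + 1" if "\<forall>g\<in>?G. \<exists>i\<in>Z. 0 < g i" for Z
    using height_le[OF that] h le B(3) by simp
  then show ?thesis using depth_le_sdepth[OF U I refl fin ne zero] by blast
qed

end
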